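(* Let $d\ge1$, let $R_j$, $j=1,\dots,d$, be the Riesz transforms on $\mathbb{R}^d$, and let $b_1,b_2$ be complex valued with $b_1,b_2\in L^3_{loc}(\mathbb{R}^d)$ and $b_1b_2\in L^2_{loc}(\mathbb{R}^d)$. Then $$S_2(b_1,b_2)+T_2(b_1,b_2)\le C_d\sum_{j=1}^d\|C_bR_j\|_{L^2\to L^2},$$ where $C_d$ depends only on $d$.
   Context: $R_jf(x)=\lim_{\varepsilon\to0}\int_{|x-y|>\varepsilon}\frac{x_j-y_j}{|x-y|^{d+1}}f(y)\,dy$. With $b=(b_1,b_2)$ and an operator $T$, the commutator $C_bT=[b_2,[b_1,T]]$ is defined on $L^\infty_c(\mathbb{R}^d)$, where $[A,B]=AB-BA$ and $b_i$ acts by pointwise multiplication; $\|C_bT\|_{L^2\to L^2}$ is the supremum of $\|C_bTf\|_{L^2}$ over $f\in L^\infty_c$ with $\|f\|_{L^2}\le1$ (possibly $+\infty$). For $0<p<\infty$ and $\langle g\rangle_Q=\frac1{|Q|}\int_Q g$, with suprema over all cubes $Q\subset\mathbb{R}^d$: $S_p(b_1,b_2)=\sup_Q\big(\frac1{|Q|}\int_Q|b_1-\langle b_1\rangle_Q|^p\big)^{1/p}\big(\frac1{|Q|}\int_Q|b_2-\langle b_2\rangle_Q|^p\big)^{1/p}$ and $T_p(b_1,b_2)=\sup_Q\big(\frac1{|Q|}\int_Q|b_1-\langle b_1\rangle_Q|^p|b_2-\langle b_2\rangle_Q|^p\big)^{1/p}$. *)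

theory Defs
  imports "HOL-Analysis.Analysis"
begin

type_synonym 'n cfun = "real^'n \<Rightarrow> complex"

definition riesz :: "'n::finite \<Rightarrow> 'n cfun \<Rightarrow> 'n cfun" where
  "riesz j f x = Lim (at_right (0::real))
     (\<lambda>\<epsilon>. LINT y:{y. \<epsilon> < dist x y}|lebesgue.
        complex_of_real ((x$j - y$j) / norm (x - y) ^ (CARD('n) + 1)) * f y)"

definition mult_op :: "'n cfun \<Rightarrow> 'n cfun \<Rightarrow> 'n cfun" where
  "mult_op b f = (\<lambda>x. b x * f x)"

definition commutator :: "('n cfun \<Rightarrow> 'n cfun) \<Rightarrow> ('n cfun \<Rightarrow> 'n cfun) \<Rightarrow> 'n cfun \<Rightarrow> 'n cfun" where
  "commutator A B = (\<lambda>f x. A (B f) x - B (A f) x)"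

definition comm2 :: "'n cfun \<Rightarrow> 'n cfun \<Rightarrow> ('n cfun \<Rightarrow> 'n cfun) \<Rightarrow> 'n cfun \<Rightarrow> 'n cfun" where
  "comm2 b1 b2 T = commutator (mult_op b2) (commutator (mult_op b1) T)"

definition Linfty_c :: "'n::finite cfun \<Rightarrow> bool" where
  "Linfty_c f \<longleftrightarrow> f \<in> borel_measurable lebesgue \<and> (\<exists>M. \<forall>x. norm (f x) \<le> M)
     \<and> bounded {x. f x \<noteq> 0}"

definition L2norm :: "'n::finite cfun \<Rightarrow> ennreal" where
  "L2norm g = (let I = (\<integral>\<^sup>+ x. ennreal ((norm (g x))\<^sup>2) \<partial>lebesgue) in
     if I = \<infinity> then \<infinity> else ennreal (sqrt (enn2real I)))"

definition opnorm_L2 :: "('n::finite cfun \<Rightarrow> 'n cfun) \<Rightarrow> ennreal" where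
  "opnorm_L2 T = (SUP f\<in>{f. Linfty_c f \<and> L2norm f \<le> 1}. L2norm (T f))"

definition locLp :: "real \<Rightarrow> 'n::finite cfun \<Rightarrow> bool" where
  "locLp p b \<longleftrightarrow> b \<in> borel_measurable lebesgue \<and>
     (\<forall>K. compact K \<longrightarrow> (\<integral>\<^sup>+ x\<in>K. ennreal (norm (b x) powr p) \<partial>lebesgue) < \<infinity>)"

definition is_cube :: "(real^'n::finite) set \<Rightarrow> bool" where
  "is_cube Q \<longleftrightarrow> (\<exists>a r. r > 0 \<and> Q = cbox a (a + r *\<^sub>R One))"

definition avg :: "(real^'n::finite) set \<Rightarrow> 'n cfun \<Rightarrow> complex" where
  "avg Q b = (LINT y:Q|lebesgue. b y) / complex_of_real (measure lebesgue Q)"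

definition osc :: "real \<Rightarrow> (real^'n::finite) set \<Rightarrow> 'n cfun \<Rightarrow> real" where
  "osc p Q b = ((LINT y:Q|lebesgue. norm (b y - avg Q b) powr p) / measure lebesgue Q) powr (1/p)"

definition Sp :: "real \<Rightarrow> 'n::finite cfun \<Rightarrow> 'n cfun \<Rightarrow> ennreal" where
  "Sp p b1 b2 = (SUP Q\<in>{Q. is_cube Q}. ennreal (osc p Q b1 * osc p Q b2))"

definition Tp :: "real \<Rightarrow> 'n::finite cfun \<Rightarrow> 'n cfun \<Rightarrow> ennreal" where
  "Tp p b1 b2 = (SUP Q\<in>{Q. is_cube Q}. ennreal
     (((LINT y:Q|lebesgue. norm (b1 y - avg Q b1) powr p * norm (b2 y - avg Q b2) powr p)
        / measure lebesgue Q) powr (1/p)))"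

end

theory Submission
  imports Defs
begin

text \<open>
  Let \<open>k(x,y) = (b1 x - b1 y) (b2 x - b2 y)\<close>. For mean-zero functions on a cube \<open>Q\<close>, expanding the square shows that
  the average of \<open>|k|\<^sup>2\<close> over \<open>Q \<times> Q\<close> dominates the squares of both oscillation quantities on \<open>Q\<close>, so it suffices to bound
  that average by the square of \<open>N\<close>, the sum of the operator norms. Away from the diagonal the commutator with \<open>R_j\<close> is the integral operator
  with kernel \<open>k(x,y) K_j(x - y)\<close>, no principal value being involved. On a product of two balls that are small compared
  with their distance, some \<open>K_j(x - y)\<close> is constant up to a factor \<open>1 + \<delta>\<close> with \<open>|\<delta>| \<le> 1/4\<close>. Since \<open>k\<close> has rank at most 4, its
  Hilbert-Schmidt norm is at most twice its operator norm, and the error from \<open>\<delta>\<close> is absorbed. Hence \<open>|k|\<^sup>2\<close>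
  has average at most a constant times \<open>N\<^sup>2\<close> on each product of balls whose radius is comparable to their distance, and
  such products cover \<open>Q \<times> Q\<close> off the diagonal with total measure at most a constant times \<open>|Q|\<^sup>2\<close>.
\<close>

subsection \<open>Finite rank kernels\<close>

text \<open>Boundedness everywhere on \<open>space M\<close>, rather than almost everywhere, is
  stable under sums, products and slices of product spaces, and over a finite measure it gives
  integrability at once. Values outside \<open>space M\<close> are left free, so over
  \<open>lebesgue_on S\<close> only the behaviour on \<open>S\<close> counts.\<close>

definition bmeas :: "'a measure \<Rightarrow> ('a \<Rightarrow> 'b::real_normed_field) \<Rightarrow> bool" where
  "bmeas M f \<longleftrightarrow> f \<in> borel_measurable M \<and> (\<exists>B. \<forall>x\<in>space M. norm (f x) \<le> B)"

lemma bmeasD: "bmeas M f \<Longrightarrow> f \<in> borel_measurable M"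
  by (simp add: bmeas_def)

lemma bmeasI: "f \<in> borel_measurable M \<Longrightarrow> (\<And>x. x \<in> space M \<Longrightarrow> norm (f x) \<le> B) \<Longrightarrow> bmeas M f"
  by (auto simp: bmeas_def)

lemma bmeas_cong: "(\<And>x. x \<in> space M \<Longrightarrow> f x = g x) \<Longrightarrow> bmeas M f \<longleftrightarrow> bmeas M g"
  by (simp add: bmeas_def cong: measurable_cong)

lemma bmeas_const: "bmeas M (\<lambda>x. c)"
  by (auto simp: bmeas_def)

lemma bmeas_add:
  fixes f g :: "'a \<Rightarrow> 'b::{real_normed_field,second_countable_topology}"
  assumes "bmeas M f" "bmeas M g"
  shows "bmeas M (\<lambda>x. f x + g x)"
proof -
  obtain A B where "\<And>x. x \<in> space M \<Longrightarrow> norm (f x) \<le> A" "\<And>x. x \<in> space M \<Longrightarrow> norm (g x) \<le> B"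
    using assms unfolding bmeas_def by blast
  then show ?thesis
    using assms by (intro bmeasI[where B="A + B"]) (auto simp: bmeas_def intro: norm_triangle_mono)
qed

lemma bmeas_mult:
  fixes f g :: "'a \<Rightarrow> 'b::{real_normed_field,second_countable_topology}"
  assumes "bmeas M f" "bmeas M g"
  shows "bmeas M (\<lambda>x. f x * g x)"
proof -
  obtain A B where AB: "\<And>x. x \<in> space M \<Longrightarrow> norm (f x) \<le> A" "\<And>x. x \<in> space M \<Longrightarrow> norm (g x) \<le> B"
    using assms unfolding bmeas_def by blast
  have "norm (f x * g x) \<le> A * B" if "x \<in> space M" for x
    unfolding norm_mult using AB[OF that] by (intro mult_mono) (auto intro: order_trans[OF norm_ge_zero])
  then show ?thesis
    using assms by (intro bmeasI[where B="A * B"]) (auto simp: bmeas_def)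
qed

lemma bmeas_uminus:
  fixes f :: "'a \<Rightarrow> 'b::{real_normed_field,second_countable_topology}"
  assumes "bmeas M f"
  shows "bmeas M (\<lambda>x. - f x)"
  using assms by (auto simp: bmeas_def)

lemma bmeas_diff:
  fixes f g :: "'a \<Rightarrow> 'b::{real_normed_field,second_countable_topology}"
  assumes "bmeas M f" "bmeas M g"
  shows "bmeas M (\<lambda>x. f x - g x)"
  using bmeas_add[OF assms(1) bmeas_uminus[OF assms(2)]] by simp

lemma bmeas_sum:
  fixes f :: "'i \<Rightarrow> 'a \<Rightarrow> 'b::{real_normed_field,second_countable_topology}"
  assumes "\<And>i. i \<in> I \<Longrightarrow> bmeas M (f i)"
  shows "bmeas M (\<lambda>x. \<Sum>i\<in>I. f i x)"
  using assms by (induction I rule: infinite_finite_induct) (auto intro: bmeas_const bmeas_add)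

lemma bmeas_cnj: "bmeas M f \<Longrightarrow> bmeas M (\<lambda>x. cnj (f x))"
  by (auto simp: bmeas_def intro!: borel_measurable_continuous_on[of cnj] continuous_intros)

lemma bmeas_cmod_sq: "bmeas M f \<Longrightarrow> bmeas M (\<lambda>x. (cmod (f x))\<^sup>2)"
  unfolding power2_eq_square by (intro bmeas_mult) (auto simp: bmeas_def)

lemmas bmeas_intros = bmeas_const bmeas_add bmeas_mult bmeas_diff bmeas_sum bmeas_cnj bmeas_cmod_sq

lemma bmeas_integrable:
  fixes f :: "'a \<Rightarrow> 'b::{real_normed_field,second_countable_topology,banach}"
  assumes "finite_measure M" "bmeas M f"
  shows "integrable M f"
proof -
  obtain B where "\<And>x. x \<in> space M \<Longrightarrow> norm (f x) \<le> B"
    using assms unfolding bmeas_def by blast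
  then show ?thesis
    using assms by (intro finite_measure.integrable_const_bound[where B=B]) (auto simp: bmeas_def)
qed

lemma bmeas_integral:
  fixes f :: "'a \<times> 'b \<Rightarrow> 'c::{real_normed_field,second_countable_topology,banach}"
  assumes fin: "finite_measure M2" and f: "bmeas (M1 \<Otimes>\<^sub>M M2) f"
  shows "bmeas M1 (\<lambda>x. \<integral>y. f (x, y) \<partial>M2)"
proof -
  interpret M2: finite_measure M2 by fact
  obtain B where B: "\<And>x. x \<in> space (M1 \<Otimes>\<^sub>M M2) \<Longrightarrow> norm (f x) \<le> B"
    using assms unfolding bmeas_def by blast
  have m: "f \<in> borel_measurable (M1 \<Otimes>\<^sub>M M2)" using f by (rule bmeasD)
  have "norm (\<integral>y. f (x, y) \<partial>M2) \<le> measure M2 (space M2) * \<bar>B\<bar>" if x: "x \<in> space M1" for x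
  proof -
    have "norm (\<integral>y. f (x, y) \<partial>M2) \<le> (\<integral>y. norm (f (x, y)) \<partial>M2)" by simp
    also have "\<dots> \<le> (\<integral>y. \<bar>B\<bar> \<partial>M2)"
    proof (rule integral_mono')
      show "norm (f (x,y)) \<le> \<bar>B\<bar>" if "y \<in> space M2" for y
        using B[of "(x,y)"] x that by (auto simp: space_pair_measure)
    qed auto
    finally show ?thesis by simp
  qed
  moreover have "(\<lambda>x. \<integral>y. f (x, y) \<partial>M2) \<in> borel_measurable M1"
    by (rule M2.borel_measurable_lebesgue_integral) (use m in simp)
  ultimately show ?thesis by (intro bmeasI)
qed

lemma bmeas_fst: "bmeas M1 f \<Longrightarrow> bmeas (M1 \<Otimes>\<^sub>M M2) (\<lambda>p. f (fst p))"
  by (auto simp: bmeas_def space_pair_measure)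

lemma bmeas_snd: "bmeas M2 f \<Longrightarrow> bmeas (M1 \<Otimes>\<^sub>M M2) (\<lambda>p. f (snd p))"
  by (auto simp: bmeas_def space_pair_measure)

lemma bmeas_slice: "bmeas (M1 \<Otimes>\<^sub>M M2) f \<Longrightarrow> x \<in> space M1 \<Longrightarrow> bmeas M2 (\<lambda>y. f (x, y))"
  by (fastforce simp: bmeas_def space_pair_measure)

section \<open>Squared moduli and the Cauchy-Schwarz inequality\<close>

lemma cmod_add_sq_le: "(cmod (a + b))\<^sup>2 \<le> 2 * (cmod a)\<^sup>2 + 2 * (cmod b)\<^sup>2"
proof -
  have "(cmod (a + b))\<^sup>2 \<le> (cmod a + cmod b)\<^sup>2" by (simp add: norm_triangle_ineq power_mono)
  also have "\<dots> \<le> 2 * (cmod a)\<^sup>2 + 2 * (cmod b)\<^sup>2"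
    using zero_le_power2[of "cmod a - cmod b"] unfolding power2_sum power2_diff by linarith
  finally show ?thesis .
qed

lemma complex_cmod_sq: "(complex_of_real (cmod z))\<^sup>2 = z * cnj z"
  by (metis complex_norm_square of_real_power)

lemma integral_mult_cnj: "(\<integral>y. f y * cnj (f y) \<partial>M) = complex_of_real (\<integral>y. (cmod (f y))\<^sup>2 \<partial>M)"
  by (simp only: complex_norm_square flip: integral_complex_of_real)

lemma integral_cnj_mult: "(\<integral>y. cnj (f y) * cnj (g y) \<partial>M) = cnj (\<integral>y. f y * g y \<partial>M)"
  by (simp only: complex_cnj_mult flip: Bochner_Integration.integral_cnj)

text \<open>Squared norms are computed below as complex integrals of \<open>h * cnj h\<close>, which
  expand linearly; this returns to the real integral.\<close>

lemma integral_cmod_sq_eqI: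
  assumes "(\<integral>y. f y * cnj (f y) \<partial>M) = complex_of_real r"
  shows "(\<integral>y. (cmod (f y))\<^sup>2 \<partial>M) = r"
  using assms unfolding integral_mult_cnj of_real_eq_iff .

text \<open>The squared modulus of \<open>t * I * cnj f - g\<close> has nonnegative integral for
  every real \<open>t\<close>, which is a quadratic inequality in \<open>t\<close>. The pairing is
  bilinear, without conjugate, as for integral operators.\<close>

lemma bmeas_Cauchy_Schwarz:
  assumes fin: "finite_measure M" and f: "bmeas M f" and g: "bmeas M g"
  shows "(cmod (\<integral>y. f y * g y \<partial>M))\<^sup>2 \<le> (\<integral>y. (cmod (f y))\<^sup>2 \<partial>M) * (\<integral>y. (cmod (g y))\<^sup>2 \<partial>M)"
proof -
  note int = bmeas_integrable[OF fin]
  define F where "F = (\<integral>y. (cmod (f y))\<^sup>2 \<partial>M)"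
  define G where "G = (\<integral>y. (cmod (g y))\<^sup>2 \<partial>M)"
  define I where "I = (\<integral>y. f y * g y \<partial>M)"
  have F0: "F \<ge> 0" and G0: "G \<ge> 0" by (auto simp: F_def G_def)
  have IJ: "(\<integral>y. cnj (f y) * cnj (g y) \<partial>M) = cnj I"
    unfolding I_def by (rule integral_cnj_mult)
  have Q: "0 \<le> F * t\<^sup>2 * (cmod I)\<^sup>2 - 2 * t * (cmod I)\<^sup>2 + G" for t :: real
  proof -
    let ?h = "\<lambda>y. of_real t * I * cnj (f y) - g y"
    have "(\<integral>y. ?h y * cnj (?h y) \<partial>M)
       = (\<integral>y. (of_real t)\<^sup>2 * I * cnj I * (f y * cnj (f y)) - (of_real t * I) * (cnj (f y) * cnj (g y))
             - (of_real t * cnj I) * (f y * g y) + g y * cnj (g y) \<partial>M)"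
      by (intro Bochner_Integration.integral_cong refl) (simp add: algebra_simps power2_eq_square)
    also have "\<dots> = (of_real t)\<^sup>2 * I * cnj I * of_real F - (of_real t * I) * cnj I - (of_real t * cnj I) * I + of_real G"
      using f g by (simp add: integral_mult_cnj F_def[symmetric] G_def[symmetric] IJ I_def[symmetric] int bmeas_intros
          )
    also have "\<dots> = of_real (F * t\<^sup>2 * (cmod I)\<^sup>2 - 2 * t * (cmod I)\<^sup>2 + G)"
      by (simp add: complex_cmod_sq algebra_simps)
    finally have "(\<integral>y. (cmod (?h y))\<^sup>2 \<partial>M) = F * t\<^sup>2 * (cmod I)\<^sup>2 - 2 * t * (cmod I)\<^sup>2 + G"
      by (rule integral_cmod_sq_eqI)
    then show ?thesis by (metis (no_types, lifting) integral_nonneg_AE AE_I2 zero_le_power2)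
  qed
  show ?thesis
  proof (cases "F = 0")
    case True
    have "I = 0"
    proof (rule ccontr)
      assume "I \<noteq> 0"
      \<comment> \<open>This \<open>t\<close> gives the quadratic the value
        \<open>- G - 2\<close>.\<close>
      then show False using Q[of "(G + 1) / (cmod I)\<^sup>2"] True G0 by simp
    qed
    then show ?thesis using F0 G0 by (simp add: I_def F_def G_def)
  next
    case False
    \<comment> \<open>With \<open>t = 1/F\<close> the quadratic becomes
      \<open>G - (cmod I)\<^sup>2 / F\<close>.\<close>
    then have "0 \<le> F * ((1/F)\<^sup>2) * (cmod I)\<^sup>2 - 2 * (1/F) * (cmod I)\<^sup>2 + G" using Q by blast
    then have "(cmod I)\<^sup>2 / F \<le> G" using False by (simp add: power2_eq_square)
    then show ?thesis using False F0 by (simp add: I_def[symmetric] F_def[symmetric] G_def[symmetric] field_simps)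
  qed
qed

text \<open>One Gram-Schmidt step per induction step: the kernel splits orthogonally into its component along the
  last right factor and a kernel of rank \<open>n\<close>, and neither part increases the operator norm.\<close>

lemma finite_rank_Hilbert_Schmidt:
  fixes a :: "nat \<Rightarrow> 'a \<Rightarrow> complex" and c :: "nat \<Rightarrow> 'b \<Rightarrow> complex"
  assumes fin1: "finite_measure M1" and fin2: "finite_measure M2" and B: "B \<ge> 0"
    and a: "\<And>i. bmeas M1 (a i)" and c: "\<And>i. bmeas M2 (c i)"
    and bd: "\<And>f. bmeas M2 f \<Longrightarrow>
      (\<integral>x. (cmod (\<integral>y. (\<Sum>i<n. a i x * c i y) * f y \<partial>M2))\<^sup>2 \<partial>M1) \<le> B * (\<integral>y. (cmod (f y))\<^sup>2 \<partial>M2)"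
  shows "(\<integral>x. (\<integral>y. (cmod (\<Sum>i<n. a i x * c i y))\<^sup>2 \<partial>M2) \<partial>M1) \<le> real n * B"
  using a c bd
proof (induction n arbitrary: a c)
  case 0
  then show ?case by simp
next
  case (Suc n)
  note i1 = bmeas_integrable[OF fin1] and i2 = bmeas_integrable[OF fin2]
  note a = Suc.prems(1) and c = Suc.prems(2)
  define s where "s = (\<integral>y. (cmod (c n y))\<^sup>2 \<partial>M2)"
  have s0: "s \<ge> 0" by (simp add: s_def)
  show ?case
  proof (cases "s = 0")
    case True
    \<comment> \<open>If \<open>c n\<close> has norm zero, its summand vanishes almost everywhere in
      \<open>y\<close>, so the rank drops to \<open>n\<close> without any orthogonalization.\<close>
    have "AE y in M2. (cmod (c n y))\<^sup>2 = 0"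
      using True unfolding s_def
      by (subst (asm) integral_nonneg_eq_0_iff_AE) (auto intro!: i2 bmeas_intros c)
    then have ae: "AE y in M2. c n y = 0" by simp
    have e: "AE y in M2. (\<Sum>i<Suc n. a i x * c i y) = (\<Sum>i<n. a i x * c i y)" for x
      using ae by (auto elim: eventually_mono)
    have m: "c i \<in> borel_measurable M2" for i using c by (rule bmeasD)
    have 1: "(\<integral>y. (cmod (\<Sum>i<Suc n. a i x * c i y))\<^sup>2 \<partial>M2) = (\<integral>y. (cmod (\<Sum>i<n. a i x * c i y))\<^sup>2 \<partial>M2)" for x
      by (intro integral_cong_AE) (use e[of x] m in \<open>auto elim: eventually_mono\<close>)
    have 2: "(\<integral>y. (\<Sum>i<Suc n. a i x * c i y) * f y \<partial>M2) = (\<integral>y. (\<Sum>i<n. a i x * c i y) * f y \<partial>M2)"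
      if "bmeas M2 f" for x f
      by (intro integral_cong_AE) (use e[of x] m bmeasD[OF that] in \<open>auto elim: eventually_mono\<close>)
    have "(\<integral>x. (\<integral>y. (cmod (\<Sum>i<n. a i x * c i y))\<^sup>2 \<partial>M2) \<partial>M1) \<le> real n * B"
      using Suc.prems(3) by (intro Suc.IH a c) (simp only: 2)
    also have "\<dots> \<le> real (Suc n) * B" using B by (simp add: algebra_simps)
    finally show ?thesis by (simp only: 1)
  next
    case False
    then have s: "s > 0" using s0 by simp
    have sc: "(\<integral>y. c n y * cnj (c n y) \<partial>M2) = of_real s"
      by (simp add: s_def integral_mult_cnj)
    \<comment> \<open>\<open>l i\<close> is the coefficient of \<open>c i\<close> along
      \<open>c n\<close>, so \<open>c' i\<close> is orthogonal to \<open>c n\<close>;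
      \<open>a'\<close> collects the left factors of everything moved into the direction
      \<open>c n\<close>.\<close>
    define l where "l i = (\<integral>y. c i y * cnj (c n y) \<partial>M2) / of_real s" for i
    define c' where "c' i y = c i y - l i * c n y" for i y
    define a' where "a' x = a n x + (\<Sum>i<n. l i * a i x)" for x
    define k' where "k' x y = (\<Sum>i<n. a i x * c' i y)" for x y
    have c': "bmeas M2 (c' i)" for i unfolding c'_def by (intro bmeas_intros c)
    have a': "bmeas M1 a'" unfolding a'_def by (intro bmeas_intros a)
    have k'2: "bmeas M2 (k' x)" for x unfolding k'_def by (intro bmeas_intros c')
    have split: "(\<Sum>i<Suc n. a i x * c i y) = k' x y + a' x * c n y" for x y
      by (simp add: k'_def a'_def c'_def algebra_simps sum.distrib sum_subtractf sum_distrib_left sum_distrib_right)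
    have orth0: "(\<integral>y. c' i y * cnj (c n y) \<partial>M2) = 0" for i
    proof -
      have "(\<integral>y. c' i y * cnj (c n y) \<partial>M2) = (\<integral>y. c i y * cnj (c n y) - l i * (c n y * cnj (c n y)) \<partial>M2)"
        by (simp add: c'_def algebra_simps)
      also have "\<dots> = (\<integral>y. c i y * cnj (c n y) \<partial>M2) - l i * of_real s"
        by (subst Bochner_Integration.integral_diff) (auto intro!: i2 bmeas_intros c simp: sc)
      finally show ?thesis using s by (simp add: l_def)
    qed
    have orth: "(\<integral>y. k' x y * cnj (c n y) \<partial>M2) = 0" for x
    proof -
      have "(\<integral>y. k' x y * cnj (c n y) \<partial>M2) = (\<integral>y. (\<Sum>i<n. a i x * (c' i y * cnj (c n y))) \<partial>M2)"
        by (simp add: k'_def sum_distrib_right mult.assoc)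
      also have "\<dots> = (\<Sum>i<n. a i x * (\<integral>y. c' i y * cnj (c n y) \<partial>M2))"
        by (subst Bochner_Integration.integral_sum) (auto intro!: i2 bmeas_intros c c')
      finally show ?thesis by (simp add: orth0)
    qed
    have orth': "(\<integral>y. cnj (k' x y) * c n y \<partial>M2) = 0" for x
      using integral_cnj_mult[of M2 "k' x" "\<lambda>y. cnj (c n y)"] by (simp add: orth)
    have norm_eq: "(\<integral>y. (cmod (\<Sum>i<Suc n. a i x * c i y))\<^sup>2 \<partial>M2)
       = (\<integral>y. (cmod (k' x y))\<^sup>2 \<partial>M2) + s * (cmod (a' x))\<^sup>2" for x
    proof -
      let ?h = "\<lambda>y. k' x y + a' x * c n y"
      have "(\<integral>y. ?h y * cnj (?h y) \<partial>M2)
        = (\<integral>y. k' x y * cnj (k' x y) + cnj (a' x) * (k' x y * cnj (c n y)) + a' x * (cnj (k' x y) * c n y)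
             + a' x * cnj (a' x) * (c n y * cnj (c n y)) \<partial>M2)"
        by (intro Bochner_Integration.integral_cong refl) (simp add: algebra_simps)
      also have "\<dots> = of_real (\<integral>y. (cmod (k' x y))\<^sup>2 \<partial>M2) + a' x * cnj (a' x) * of_real s"
        by (simp add: orth orth' sc integral_mult_cnj i2 bmeas_intros c k'2 s_def[symmetric])
      also have "\<dots> = of_real ((\<integral>y. (cmod (k' x y))\<^sup>2 \<partial>M2) + s * (cmod (a' x))\<^sup>2)"
        by (simp add: complex_cmod_sq)
      finally show ?thesis unfolding split by (rule integral_cmod_sq_eqI)
    qed
    \<comment> \<open>Removing from \<open>f\<close> its component along \<open>cnj (c n)\<close>
      gives \<open>f'\<close> with no larger norm, and the full kernel acts on \<open>f'\<close> as
      \<open>k'\<close> acts on \<open>f\<close>. Thus \<open>k'\<close> inherits the bound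
      \<open>B\<close>.\<close>
    have bd': "(\<integral>x. (cmod (\<integral>y. (\<Sum>i<n. a i x * c' i y) * f y \<partial>M2))\<^sup>2 \<partial>M1) \<le> B * (\<integral>y. (cmod (f y))\<^sup>2 \<partial>M2)"
      if f: "bmeas M2 f" for f
    proof -
      define m where "m = (\<integral>y. c n y * f y \<partial>M2) / of_real s"
      define f' where "f' y = f y - m * cnj (c n y)" for y
      have f': "bmeas M2 f'" unfolding f'_def by (intro bmeas_intros f c)
      have cf: "(\<integral>y. c n y * f y \<partial>M2) = m * of_real s" using s by (simp add: m_def)
      have cf': "(\<integral>y. cnj (c n y) * cnj (f y) \<partial>M2) = cnj m * of_real s"
        by (simp add: integral_cnj_mult cf)
      have eq: "(\<integral>y. (\<Sum>i<Suc n. a i x * c i y) * f' y \<partial>M2) = (\<integral>y. k' x y * f y \<partial>M2)" for x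
      proof -
        have "(\<integral>y. (\<Sum>i<Suc n. a i x * c i y) * f' y \<partial>M2) = 
          (\<integral>y. k' x y * f y - m * (k' x y * cnj (c n y)) + a' x * (c n y * f y) - a' x * m * (c n y * cnj (c n y)) \<partial>M2)"
          unfolding split f'_def by (simp add: algebra_simps)
        also have "\<dots> = (\<integral>y. k' x y * f y \<partial>M2) - m * 0 + a' x * (m * of_real s) - a' x * m * of_real s"
          by (simp add: orth sc cf i2 bmeas_intros c k'2 f)
        finally show ?thesis by simp
      qed
      have "(\<integral>y. f' y * cnj (f' y) \<partial>M2)
        = (\<integral>y. f y * cnj (f y) - m * (cnj (c n y) * cnj (f y)) - cnj m * (c n y * f y) 
             + m * cnj m * (c n y * cnj (c n y)) \<partial>M2)"
        unfolding f'_def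
        by (intro Bochner_Integration.integral_cong refl) (simp add: algebra_simps)
      also have "\<dots> = of_real (\<integral>y. (cmod (f y))\<^sup>2 \<partial>M2) - m * cnj m * of_real s"
        by (simp add: cf cf' integral_mult_cnj s_def[symmetric] i2 bmeas_intros c f)
      also have "\<dots> = of_real ((\<integral>y. (cmod (f y))\<^sup>2 \<partial>M2) - s * (cmod m)\<^sup>2)"
        by (simp add: complex_cmod_sq)
      finally have "(\<integral>y. (cmod (f' y))\<^sup>2 \<partial>M2) = (\<integral>y. (cmod (f y))\<^sup>2 \<partial>M2) - s * (cmod m)\<^sup>2"
        by (rule integral_cmod_sq_eqI)
      then have le: "(\<integral>y. (cmod (f' y))\<^sup>2 \<partial>M2) \<le> (\<integral>y. (cmod (f y))\<^sup>2 \<partial>M2)" using s0 by simp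
      show ?thesis
        using Suc.prems(3)[OF f'] mult_left_mono[OF le B] unfolding eq by (simp add: k'_def)
    qed
    have IH: "(\<integral>x. (\<integral>y. (cmod (k' x y))\<^sup>2 \<partial>M2) \<partial>M1) \<le> real n * B"
      unfolding k'_def using bd' by (intro Suc.IH a c')
    \<comment> \<open>Tested against \<open>cnj (c n)\<close>, the full kernel shows only its
      component along \<open>c n\<close>, which costs one further \<open>B\<close>.\<close>
    have A: "(\<integral>y. (\<Sum>i<Suc n. a i x * c i y) * cnj (c n y) \<partial>M2) = a' x * of_real s" for x
      unfolding split by (simp add: distrib_right mult.assoc orth sc i2 bmeas_intros c k'2)
    have "s\<^sup>2 * (\<integral>x. (cmod (a' x))\<^sup>2 \<partial>M1) \<le> s * B"
      using Suc.prems(3)[OF bmeas_cnj[OF c[of n]]] unfolding A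
      by (simp add: norm_mult power_mult_distrib s_def[symmetric] mult.commute)
    then have A2: "s * (\<integral>x. (cmod (a' x))\<^sup>2 \<partial>M1) \<le> B" using s by (simp add: power2_eq_square)
    have k'12: "bmeas (M1 \<Otimes>\<^sub>M M2) (\<lambda>p. k' (fst p) (snd p))"
      unfolding k'_def by (intro bmeas_intros bmeas_fst bmeas_snd a c')
    have "(\<integral>x. (\<integral>y. (cmod (\<Sum>i<Suc n. a i x * c i y))\<^sup>2 \<partial>M2) \<partial>M1)
       = (\<integral>x. (\<integral>y. (cmod (k' x y))\<^sup>2 \<partial>M2) \<partial>M1) + s * (\<integral>x. (cmod (a' x))\<^sup>2 \<partial>M1)"
      unfolding norm_eq using i1[OF bmeas_integral[OF fin2 bmeas_cmod_sq[OF k'12]]] i1[OF bmeas_cmod_sq[OF a']]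
      by simp
    also have "\<dots> \<le> real (Suc n) * B" using IH A2 by (simp add: algebra_simps)
    finally show ?thesis .
  qed
qed

text \<open>Replacing the kernel \<open>k\<close> by \<open>k (1 + \<delta>)\<close> costs at most a small multiple of the Hilbert-Schmidt norm of \<open>k\<close>,
  which for finite rank can be absorbed.\<close>

lemma perturbed_rank4_Hilbert_Schmidt:
  fixes a :: "nat \<Rightarrow> 'a \<Rightarrow> complex" and c :: "nat \<Rightarrow> 'b \<Rightarrow> complex"
  assumes fin1: "finite_measure M1" and fin2: "finite_measure M2" and B: "B \<ge> 0"
    and a: "\<And>i. bmeas M1 (a i)" and c: "\<And>i. bmeas M2 (c i)"
    and k: "\<And>x y. k x y = (\<Sum>i<4. a i x * c i y)"
    and \<delta>: "(\<lambda>p. \<delta> (fst p) (snd p)) \<in> borel_measurable (M1 \<Otimes>\<^sub>M M2)"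
    and \<delta>4: "\<And>x y. x \<in> space M1 \<Longrightarrow> y \<in> space M2 \<Longrightarrow> cmod (\<delta> x y) \<le> 1/4"
    and bd: "\<And>f. bmeas M2 f \<Longrightarrow>
      (\<integral>x. (cmod (\<integral>y. k x y * (1 + \<delta> x y) * f y \<partial>M2))\<^sup>2 \<partial>M1) \<le> B * (\<integral>y. (cmod (f y))\<^sup>2 \<partial>M2)"
  shows "(\<integral>x. (\<integral>y. (cmod (k x y))\<^sup>2 \<partial>M2) \<partial>M1) \<le> 16 * B"
proof -
  note i1 = bmeas_integrable[OF fin1] and i2 = bmeas_integrable[OF fin2]
  define H where "H = (\<integral>x. (\<integral>y. (cmod (k x y))\<^sup>2 \<partial>M2) \<partial>M1)"
  have H0: "H \<ge> 0" by (simp add: H_def)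
  have k12: "bmeas (M1 \<Otimes>\<^sub>M M2) (\<lambda>p. k (fst p) (snd p))"
    unfolding k by (intro bmeas_intros bmeas_fst bmeas_snd a c)
  have \<delta>12: "bmeas (M1 \<Otimes>\<^sub>M M2) (\<lambda>p. \<delta> (fst p) (snd p))"
    using \<delta> \<delta>4 by (intro bmeasI[where B="1/4"]) (auto simp: space_pair_measure)
  have k2: "bmeas M2 (k x)" if "x \<in> space M1" for x using bmeas_slice[OF k12 that] by simp
  have \<delta>2: "bmeas M2 (\<delta> x)" if "x \<in> space M1" for x using bmeas_slice[OF \<delta>12 that] by simp
  \<comment> \<open>Since \<open>k = k (1 + \<delta>) - k \<delta>\<close>, the kernel
    \<open>k\<close> satisfies the bound with \<open>2 * B + H / 8\<close>: the 2 comes from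
    squaring a sum of two terms, and \<open>1/8 = 2 * (1/4)^2\<close> from Cauchy-Schwarz and the
    bound on \<open>\<delta>\<close>. The rank factor 4 turns this into
    \<open>8 * B + H / 2\<close>, and the finite \<open>H\<close> is absorbed.\<close>
  have "H \<le> real 4 * (2 * B + H / 8)"
    unfolding H_def k
  proof (rule finite_rank_Hilbert_Schmidt[OF fin1 fin2 _ a c])
    show "0 \<le> 2 * B + (\<integral>x. (\<integral>y. (cmod (\<Sum>i<4. a i x * c i y))\<^sup>2 \<partial>M2) \<partial>M1) / 8"
      using H0 B by (simp add: H_def k)
    fix f :: "'b \<Rightarrow> complex" assume f: "bmeas M2 f"
    define F where "F = (\<integral>y. (cmod (f y))\<^sup>2 \<partial>M2)"
    have F0: "F \<ge> 0" by (simp add: F_def)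
    define A1 where "A1 x = (\<integral>y. k x y * (1 + \<delta> x y) * f y \<partial>M2)" for x
    define A2 where "A2 x = (\<integral>y. (k x y * \<delta> x y) * f y \<partial>M2)" for x
    define h where "h x = (\<integral>y. (cmod (k x y))\<^sup>2 \<partial>M2)" for x
    have bA: "bmeas M1 (\<lambda>x. \<integral>y. k x y * f y \<partial>M2)"
      using bmeas_integral[OF fin2 bmeas_mult[OF k12 bmeas_snd[OF f]]] by simp
    have bA1: "bmeas M1 A1"
      using bmeas_integral[OF fin2 bmeas_mult[OF bmeas_mult[OF k12 bmeas_add[OF bmeas_const[of _ 1] \<delta>12]] bmeas_snd[OF f]]] 
      unfolding A1_def by simp
    have bh: "bmeas M1 h"
      using bmeas_integral[OF fin2 bmeas_cmod_sq[OF k12]] unfolding h_def by simp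
    have "(\<integral>x. (cmod (\<integral>y. k x y * f y \<partial>M2))\<^sup>2 \<partial>M1) \<le> (\<integral>x. 2 * (cmod (A1 x))\<^sup>2 + F / 8 * h x \<partial>M1)"
    proof (rule integral_mono)
      show "integrable M1 (\<lambda>x. (cmod (\<integral>y. k x y * f y \<partial>M2))\<^sup>2)" 
        "integrable M1 (\<lambda>x. 2 * (cmod (A1 x))\<^sup>2 + F / 8 * h x)"
        by (intro i1 bmeas_intros bA bA1 bh)+
      fix x assume x: "x \<in> space M1"
      have "(\<integral>y. k x y * f y \<partial>M2) = (\<integral>y. k x y * (1 + \<delta> x y) * f y - (k x y * \<delta> x y) * f y \<partial>M2)"
        by (simp add: algebra_simps)
      also have "\<dots> = A1 x + (- A2 x)"
        unfolding A1_def A2_def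
        by (subst Bochner_Integration.integral_diff) (auto intro!: i2 bmeas_intros k2 \<delta>2 x f)
      finally have "(cmod (\<integral>y. k x y * f y \<partial>M2))\<^sup>2 \<le> 2 * (cmod (A1 x))\<^sup>2 + 2 * (cmod (A2 x))\<^sup>2"
        using cmod_add_sq_le[of "A1 x" "- A2 x"] by simp
      moreover have "(cmod (A2 x))\<^sup>2 \<le> (\<integral>y. (cmod (k x y * \<delta> x y))\<^sup>2 \<partial>M2) * F"
        unfolding A2_def F_def by (intro bmeas_Cauchy_Schwarz fin2 bmeas_intros k2 \<delta>2 x f)
      moreover have "(\<integral>y. (cmod (k x y * \<delta> x y))\<^sup>2 \<partial>M2) \<le> (\<integral>y. (cmod (k x y))\<^sup>2 * (1/16) \<partial>M2)"
      proof (intro integral_mono i2 bmeas_intros k2 \<delta>2 x)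
        fix y assume "y \<in> space M2"
        then have "(cmod (\<delta> x y))\<^sup>2 \<le> (1/4)\<^sup>2" by (intro power_mono \<delta>4 x) auto
        then show "(cmod (k x y * \<delta> x y))\<^sup>2 \<le> (cmod (k x y))\<^sup>2 * (1/16)"
          unfolding norm_mult power_mult_distrib by (intro mult_left_mono) (auto simp: power2_eq_square)
      qed
      then have "(\<integral>y. (cmod (k x y * \<delta> x y))\<^sup>2 \<partial>M2) * F \<le> h x / 16 * F"
        by (intro mult_right_mono F0) (simp add: h_def)
      ultimately show "(cmod (\<integral>y. k x y * f y \<partial>M2))\<^sup>2 \<le> 2 * (cmod (A1 x))\<^sup>2 + F / 8 * h x"
        by (simp add: algebra_simps)
    qed
    also have "\<dots> = 2 * (\<integral>x. (cmod (A1 x))\<^sup>2 \<partial>M1) + F / 8 * H"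
      unfolding H_def h_def[symmetric] using i1[OF bmeas_cmod_sq[OF bA1]] i1[OF bh] by simp
    also have "\<dots> \<le> 2 * (B * F) + F / 8 * H"
      using bd[OF f] by (simp add: A1_def F_def)
    finally show "(\<integral>x. (cmod (\<integral>y. (\<Sum>i<4. a i x * c i y) * f y \<partial>M2))\<^sup>2 \<partial>M1)
      \<le> (2 * B + (\<integral>x. (\<integral>y. (cmod (\<Sum>i<4. a i x * c i y))\<^sup>2 \<partial>M2) \<partial>M1) / 8) * (\<integral>y. (cmod (f y))\<^sup>2 \<partial>M2)"
      unfolding k H_def F_def by (simp add: algebra_simps)
  qed
  then show ?thesis unfolding H_def by simp
qed

subsection \<open>Products of differences\<close>

text \<open>If \<open>X\<close>, \<open>Y\<close> are independent and \<open>u\<close>, \<open>v\<close> have mean zero, the mixed third order terms of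
  \<open>E |u(X) - u(Y)|\<^sup>2 |v(X) - v(Y)|\<^sup>2\<close> vanish and the remaining cross terms
  \<open>2 |E u v|\<^sup>2 + 2 |E u cnj v|\<^sup>2\<close> are nonnegative.\<close>

lemma integral_double_difference_ge:
  fixes u v :: "'a \<Rightarrow> complex"
  assumes fin: "finite_measure M"
    and u: "integrable M u" and v: "integrable M v"
    and uv: "integrable M (\<lambda>x. u x * v x)" 
    and p: "integrable M (\<lambda>x. (cmod (u x))\<^sup>2)" and q: "integrable M (\<lambda>x. (cmod (v x))\<^sup>2)"
    and pq: "integrable M (\<lambda>x. (cmod (u x))\<^sup>2 * (cmod (v x))\<^sup>2)"
    and pv: "integrable M (\<lambda>x. of_real ((cmod (u x))\<^sup>2) * v x)"
    and qu: "integrable M (\<lambda>x. of_real ((cmod (v x))\<^sup>2) * u x)"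
    and u0: "(\<integral>x. u x \<partial>M) = 0" and v0: "(\<integral>x. v x \<partial>M) = 0"
  shows "ennreal (2 * measure M (space M) * (\<integral>x. (cmod (u x))\<^sup>2 * (cmod (v x))\<^sup>2 \<partial>M)
           + 2 * (\<integral>x. (cmod (u x))\<^sup>2 \<partial>M) * (\<integral>x. (cmod (v x))\<^sup>2 \<partial>M))
    \<le> (\<integral>\<^sup>+x. (\<integral>\<^sup>+y. ennreal ((cmod (u x - u y))\<^sup>2 * (cmod (v x - v y))\<^sup>2) \<partial>M) \<partial>M)"
proof -
  interpret finite_measure M by fact
  define P where "P = (\<integral>x. (cmod (u x))\<^sup>2 \<partial>M)"
  define Q where "Q = (\<integral>x. (cmod (v x))\<^sup>2 \<partial>M)"
  define PQ where "PQ = (\<integral>x. (cmod (u x))\<^sup>2 * (cmod (v x))\<^sup>2 \<partial>M)"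
  \<comment> \<open>The measure is not normalized, so the total mass \<open>m\<close> appears where
    a probability measure would give 1.\<close>
  define m where "m = measure M (space M)"
  define E where "E = (\<integral>x. of_real ((cmod (u x))\<^sup>2) * v x \<partial>M)"
  define F where "F = (\<integral>x. of_real ((cmod (v x))\<^sup>2) * u x \<partial>M)"
  define A where "A = (\<integral>x. u x * v x \<partial>M)"
  define D where "D = (\<integral>x. u x * cnj (v x) \<partial>M)"
  have um: "u \<in> borel_measurable M" and vm: "v \<in> borel_measurable M" using u v by auto
  have cvm: "(\<lambda>x. cnj (v x)) \<in> borel_measurable M"
    using vm by (auto intro!: borel_measurable_continuous_on[of cnj] continuous_intros)
  have uv': "integrable M (\<lambda>x. u x * cnj (v x))"
    by (rule Bochner_Integration.integrable_bound[OF uv]) (use um cvm in \<open>auto simp: norm_mult\<close>)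
  define g where "g x = (cmod (u x))\<^sup>2 * (cmod (v x))\<^sup>2 * m + (cmod (u x))\<^sup>2 * Q + P * (cmod (v x))\<^sup>2 + PQ
     - 2 * Re (cnj (v x) * E) - 2 * Re (cnj (u x) * F)
     + 2 * Re (cnj (u x * v x) * A) + 2 * Re (cnj (u x * cnj (v x)) * D)" for x
  \<comment> \<open>Cross terms are arranged as a factor in \<open>x\<close> times a factor in
    \<open>y\<close>, using \<open>4 Re z Re w = 2 Re (z w) + 2 Re (z cnj w)\<close>, so that the
    integral over \<open>y\<close> can be taken factor by factor. The last two terms then vanish
    because \<open>u\<close> and \<open>v\<close> have mean zero.\<close>
  have expand: "(cmod (u x - u y))\<^sup>2 * (cmod (v x - v y))\<^sup>2
      = (cmod (u x))\<^sup>2 * (cmod (v x))\<^sup>2 + (cmod (u x))\<^sup>2 * (cmod (v y))\<^sup>2 + (cmod (u y))\<^sup>2 * (cmod (v x))\<^sup>2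
       + (cmod (u y))\<^sup>2 * (cmod (v y))\<^sup>2
       - 2 * Re (cnj (v x) * (of_real ((cmod (u y))\<^sup>2) * v y)) - 2 * Re (cnj (u x) * (of_real ((cmod (v y))\<^sup>2) * u y))
       + 2 * Re (cnj (u x * v x) * (u y * v y)) + 2 * Re (cnj (u x * cnj (v x)) * (u y * cnj (v y)))
       - 2 * (cmod (u x))\<^sup>2 * Re (cnj (v x) * v y) - 2 * (cmod (v x))\<^sup>2 * Re (cnj (u x) * u y)" (is "?L x y = ?R x y") for x y
    unfolding cmod_power2 by (simp add: power2_eq_square) algebra
  have innerB: "(\<integral>y. ?R x y \<partial>M) = g x" for x
    by (simp add: g_def P_def Q_def PQ_def E_def F_def A_def D_def m_def u0 v0 u v uv uv' p q pq pv qu 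
         del: of_real_power times_complex.simps complex_cnj_mult)
  have inner: "(\<integral>\<^sup>+y. ennreal (?L x y) \<partial>M) = ennreal (g x)" for x
  proof -
    have int: "integrable M (?R x)"
      by (intro Bochner_Integration.integrable_add Bochner_Integration.integrable_diff
          integrable_mult_right integrable_Re integrable_const u v uv uv' p q pq pv qu integrable_mult_left)
    have "integrable M (?L x)" unfolding expand by (rule int)
    then have "(\<integral>\<^sup>+y. ennreal (?L x y) \<partial>M) = ennreal (\<integral>y. ?L x y \<partial>M)"
      by (intro nn_integral_eq_integral) simp_all
    then show ?thesis by (simp only: expand innerB)
  qed
  have g0: "g x \<ge> 0" for x
  proof -
    have "?R x y \<ge> 0" for y unfolding expand[symmetric] by simp
    then have "(\<integral>y. ?R x y \<partial>M) \<ge> 0" by (rule Bochner_Integration.integral_nonneg)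
    then show ?thesis by (simp only: innerB)
  qed
  have ic: "integrable M (\<lambda>x. cnj (u x))" "integrable M (\<lambda>x. cnj (v x))" "integrable M (\<lambda>x. cnj (u x * v x))"
    "integrable M (\<lambda>x. cnj (u x * cnj (v x)))"
    using u v uv uv' by (simp_all only: integrable_cnj)
  have ig: "integrable M g"
    unfolding g_def
    by (intro Bochner_Integration.integrable_add Bochner_Integration.integrable_diff
          integrable_mult_right integrable_Re integrable_const u v p q pq ic integrable_mult_left)
  \<comment> \<open>The terms with \<open>E\<close> and \<open>F\<close> integrate to zero in
    \<open>x\<close>; those with \<open>A\<close> and \<open>D\<close> give squared moduli and are
    dropped in the step that follows.\<close>
  have "(\<integral>x. g x \<partial>M) = 2 * m * PQ + 2 * P * Q + 2 * Re (cnj A * A) + 2 * Re (cnj D * D)"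
    unfolding g_def
    by (simp add: P_def[symmetric] Q_def[symmetric] PQ_def[symmetric] A_def[symmetric] D_def[symmetric]
         m_def[symmetric] u0 v0 u v uv uv' p q pq ic del: of_real_power times_complex.simps complex_cnj_mult)
  also have "\<dots> \<ge> 2 * m * PQ + 2 * P * Q" by simp
  finally have "2 * m * PQ + 2 * P * Q \<le> (\<integral>x. g x \<partial>M)" .
  moreover have "(\<integral>\<^sup>+x. ennreal (g x) \<partial>M) = ennreal (\<integral>x. g x \<partial>M)"
    using ig g0 by (intro nn_integral_eq_integral) auto
  ultimately show ?thesis
    unfolding inner P_def[symmetric] Q_def[symmetric] PQ_def[symmetric] m_def[symmetric]
    by (simp only: ennreal_leI)
qed

subsection \<open>Riesz kernels off the support\<close>

definition riesz_kernel :: "'n::finite \<Rightarrow> real^'n \<Rightarrow> real" where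
  "riesz_kernel j z = z $ j / norm z ^ (CARD('n) + 1)"

lemma riesz_kernel_measurable [measurable]: "riesz_kernel j \<in> borel_measurable borel"
  unfolding riesz_kernel_def by measurable

lemma riesz_kernel_scale:
  fixes z :: "real^'n::finite"
  assumes "t > 0"
  shows "riesz_kernel j (t *\<^sub>R z) = riesz_kernel j z / t ^ CARD('n)"
  using assms by (simp add: riesz_kernel_def power_mult_distrib)

lemma riesz_kernel_bound:
  fixes z :: "real^'n::finite"
  assumes "e \<le> norm z" "e > 0"
  shows "\<bar>riesz_kernel j z\<bar> \<le> 1 / e ^ CARD('n)"
proof -
  have "norm z > 0" using assms by linarith
  then have "\<bar>riesz_kernel j z\<bar> \<le> norm z / norm z ^ (CARD('n) + 1)"
    unfolding riesz_kernel_def abs_divide using component_le_norm_cart[of z j]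
    by (intro frac_le) auto
  also have "\<dots> = 1 / norm z ^ CARD('n)" using assms by auto
  also have "\<dots> \<le> 1 / e ^ CARD('n)" using assms \<open>norm z > 0\<close> by (intro divide_left_mono power_mono) auto
  finally show ?thesis .
qed

text \<open>Uniform continuity on a compact annulus around the unit sphere, with one
  \<open>\<eta>\<close> for the finitely many \<open>j\<close>. The tolerance is a quarter of
  \<open>1 / CARD('n)\<close>, a lower bound for the largest coordinate of a unit vector, so that it
  becomes a relative error of 1/4.\<close>

lemma riesz_kernel_nearly_constant_unit:
  obtains \<eta> :: real where "\<eta> > 0"
    "\<And>(z0 :: real^'n::finite) z j. norm z0 = 1 \<Longrightarrow> norm (z - z0) < \<eta> \<Longrightarrow>
       \<bar>riesz_kernel j z - riesz_kernel j z0\<bar> < 1 / (4 * real CARD('n))"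
proof -
  define S where "S = cball (0 :: real^'n) 2 - ball 0 (1/2)"
  have "compact S" unfolding S_def by (intro compact_diff) auto
  have "continuous_on S (riesz_kernel j)" for j
    unfolding riesz_kernel_def by (intro continuous_intros) (auto simp: S_def)
  then have uc: "uniformly_continuous_on S (riesz_kernel j)" for j
    by (rule compact_uniformly_continuous) fact
  have "\<exists>e>0. \<forall>x\<in>S. \<forall>x'\<in>S. dist x' x < e \<longrightarrow> dist (riesz_kernel j x') (riesz_kernel j x) < 1 / (4 * real CARD('n))" for j
    using uc[of j] unfolding uniformly_continuous_on_def by (auto dest!: spec[where x="1 / (4 * real CARD('n))"])
  then obtain e where e: "\<And>j. e j > 0" "\<And>j x x'. x \<in> S \<Longrightarrow> x' \<in> S \<Longrightarrow> dist x' x < e j \<Longrightarrow>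
      dist (riesz_kernel j x') (riesz_kernel j x) < 1 / (4 * real CARD('n))"
    by metis
  \<comment> \<open>The entry 1/2 keeps \<open>z\<close> inside the annulus
    \<open>S\<close>.\<close>
  define \<eta> where "\<eta> = Min (insert (1/2) (range e))"
  have "\<eta> > 0" "\<eta> \<le> 1/2" using e(1) by (auto simp: \<eta>_def)
  moreover have "\<eta> \<le> e j" for j unfolding \<eta>_def by (rule Min_le) auto
  moreover have "\<bar>riesz_kernel j z - riesz_kernel j z0\<bar> < 1 / (4 * real CARD('n))"
    if "norm z0 = 1" "norm (z - z0) < \<eta>" for z0 z :: "real^'n" and j
  proof -
    have "norm z \<ge> 1/2" "norm z \<le> 2"
      using that \<open>\<eta> \<le> 1/2\<close> norm_triangle_ineq2[of z0 z] norm_triangle_ineq2[of z z0] by (auto simp: norm_minus_commute)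
    then have "z \<in> S" "z0 \<in> S" using that by (auto simp: S_def)
    moreover have "dist z z0 < e j" using that \<open>\<eta> \<le> e j\<close> by (simp add: dist_norm)
    ultimately show ?thesis using e(2)[of z0 z j] by (simp add: dist_real_def)
  qed
  ultimately show ?thesis using that by blast
qed

text \<open>By homogeneity the question reduces to unit vectors. Which \<open>j\<close> works
  depends on the direction of \<open>z0\<close>; this is where the need to control every Riesz
  transform comes from.\<close>

lemma riesz_kernel_nearly_constant:
  obtains \<eta> :: real where "\<eta> > 0" "\<eta> \<le> 1/4"
    "\<And>z0 :: real^'n::finite. z0 \<noteq> 0 \<Longrightarrow> \<exists>j. riesz_kernel j z0 \<noteq> 0 \<and> 1 / \<bar>riesz_kernel j z0\<bar> \<le> real CARD('n) * norm z0 ^ CARD('n)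
       \<and> (\<forall>z. norm (z - z0) \<le> 2 * \<eta> * norm z0 \<longrightarrow> \<bar>riesz_kernel j z / riesz_kernel j z0 - 1\<bar> \<le> 1/4)"
proof -
  let ?d = "CARD('n)"
  obtain e where e: "e > 0" "\<And>(z0 :: real^'n) z j. norm z0 = 1 \<Longrightarrow> norm (z - z0) < e \<Longrightarrow>
       \<bar>riesz_kernel j z - riesz_kernel j z0\<bar> < 1 / (4 * real CARD('n))"
    by (rule riesz_kernel_nearly_constant_unit[where 'n='n]) blast
  \<comment> \<open>The entry \<open>e/4\<close> makes \<open>2 * \<eta> < e\<close>; the cap 1/4
    later keeps two balls separated when their radius is at most \<open>\<eta>\<close> times the
    distance of their centers.\<close>
  define \<eta> where "\<eta> = min (1/4) (e/4)"
  have \<eta>: "\<eta> > 0" "\<eta> \<le> 1/4" "2 * \<eta> < e" using e(1) by (auto simp: \<eta>_def)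
  moreover have "\<exists>j. riesz_kernel j z0 \<noteq> 0 \<and> 1 / \<bar>riesz_kernel j z0\<bar> \<le> real ?d * norm z0 ^ ?d
       \<and> (\<forall>z. norm (z - z0) \<le> 2 * \<eta> * norm z0 \<longrightarrow> \<bar>riesz_kernel j z / riesz_kernel j z0 - 1\<bar> \<le> 1/4)"
    if z0: "z0 \<noteq> 0" for z0 :: "real^'n"
  proof -
    define t where "t = norm z0"
    have t: "t > 0" using z0 by (simp add: t_def)
    define w where "w = z0 /\<^sub>R t"
    have w1: "norm w = 1" using t by (simp add: w_def t_def)
    have zw: "z0 = t *\<^sub>R w" using t by (simp add: w_def)
    \<comment> \<open>Otherwise the absolute coordinates of \<open>w\<close> would sum to less than
      1, the norm of \<open>w\<close>.\<close>
    have "\<exists>j. \<bar>w $ j\<bar> \<ge> 1 / real ?d"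
    proof (rule ccontr)
      assume "\<not> ?thesis"
      then have "(\<Sum>j\<in>UNIV. \<bar>w $ j\<bar>) < (\<Sum>j\<in>(UNIV::'n set). 1 / real ?d)"
        by (intro sum_strict_mono) (auto simp: not_le)
      then show False using norm_le_l1_cart[of w] w1 by simp
    qed
    then obtain j where j: "\<bar>w $ j\<bar> \<ge> 1 / real ?d" by blast
    have rw: "riesz_kernel j w = w $ j" by (simp add: riesz_kernel_def w1)
    have "1 / real ?d > 0" by simp
    then have w0: "\<bar>w $ j\<bar> > 0" using j by linarith
    have r0: "riesz_kernel j z0 = w $ j / t ^ ?d" unfolding zw using riesz_kernel_scale[OF t, of j w] by (simp add: rw)
    have "1 / \<bar>riesz_kernel j z0\<bar> = t ^ ?d * (1 / \<bar>w $ j\<bar>)" using t by (simp add: r0 abs_divide)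
    also have "\<dots> \<le> t ^ ?d * real ?d"
      using j w0 t by (intro mult_left_mono) (auto simp: field_simps)
    finally have b: "1 / \<bar>riesz_kernel j z0\<bar> \<le> real ?d * norm z0 ^ ?d" by (simp add: t_def mult.commute)
    have "\<bar>riesz_kernel j z / riesz_kernel j z0 - 1\<bar> \<le> 1/4" if z: "norm (z - z0) \<le> 2 * \<eta> * norm z0" for z
    proof -
      define v where "v = z /\<^sub>R t"
      have zv: "z = t *\<^sub>R v" using t by (simp add: v_def)
      have "z - z0 = t *\<^sub>R (v - w)" by (simp add: zv zw scaleR_diff_right)
      then have "t * norm (v - w) \<le> t * (2 * \<eta>)" using z t by (simp add: t_def[symmetric] mult.commute)
      then have "norm (v - w) < e" using t \<eta>(3) by simp
      then have "\<bar>riesz_kernel j v - w $ j\<bar> < 1 / (4 * real ?d)" using e(2)[OF w1] rw by metis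
      also have "\<dots> \<le> \<bar>w $ j\<bar> / 4" using j by simp
      finally have "\<bar>riesz_kernel j v - w $ j\<bar> / \<bar>w $ j\<bar> \<le> 1/4" using w0 by (simp add: field_simps)
      moreover have "riesz_kernel j z / riesz_kernel j z0 - 1 = (riesz_kernel j v - w $ j) / w $ j"
        using riesz_kernel_scale[OF t, of j v] t w0 by (simp add: zv r0 field_simps)
      ultimately show ?thesis by (simp add: abs_divide)
    qed
    then show ?thesis using b w0 t r0 by (intro exI[of _ j]) auto
  qed
  ultimately show ?thesis using that by blast
qed

text \<open>Truncations with \<open>\<epsilon> < e\<close> do not touch the support of
  \<open>g\<close>, so the principal value is the limit of an eventually constant function.\<close>

lemma riesz_off_support:
  fixes g :: "'n::finite cfun"
  assumes "e > 0" "\<And>y. g y \<noteq> 0 \<Longrightarrow> e \<le> dist x y"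
  shows "riesz j g x = (LINT y|lebesgue. of_real (riesz_kernel j (x - y)) * g y)"
proof -
  let ?I = "LINT y|lebesgue. of_real (riesz_kernel j (x - y)) * g y"
  have "(LINT y:{y. \<epsilon> < dist x y}|lebesgue. complex_of_real ((x$j - y$j) / norm (x - y) ^ (CARD('n) + 1)) * g y) = ?I"
    if "\<epsilon> < e" for \<epsilon>
    unfolding set_lebesgue_integral_def
    by (intro Bochner_Integration.integral_cong refl) (use assms(2) that in \<open>force simp: riesz_kernel_def indicator_def\<close>)
  then have "((\<lambda>\<epsilon>. LINT y:{y. \<epsilon> < dist x y}|lebesgue. complex_of_real ((x$j - y$j) / norm (x - y) ^ (CARD('n) + 1)) * g y) \<longlongrightarrow> ?I) (at_right 0)"
    by (intro tendsto_eventually eventually_at_rightI[of 0 e] assms) auto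
  then show ?thesis unfolding riesz_def by (intro tendsto_Lim) auto
qed

text \<open>The double commutator has four terms, each a Riesz transform of \<open>f\<close> times
  1, \<open>b1\<close>, \<open>b2\<close> or \<open>b1 * b2\<close>. Off the support all four are
  absolutely convergent integrals, since the symbols are bounded on \<open>S\<close>, and they
  combine into the product of differences.\<close>

lemma comm2_riesz_off_support:
  fixes b1 b2 f :: "'n::finite cfun"
  assumes S: "S \<in> lmeasurable" and e: "e > 0" "\<And>y. y \<in> S \<Longrightarrow> e \<le> dist x y"
    and b: "bmeas (lebesgue_on S) b1" "bmeas (lebesgue_on S) b2" and f: "bmeas (lebesgue_on S) f"
    and f0: "\<And>y. y \<notin> S \<Longrightarrow> f y = 0"
  shows "comm2 b1 b2 (riesz j) f x
    = (LINT y|lebesgue_on S. (b1 x - b1 y) * (b2 x - b2 y) * of_real (riesz_kernel j (x - y)) * f y)"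
proof -
  have R: "riesz j (\<lambda>y. h y * f y) x = (LINT y|lebesgue_on S. of_real (riesz_kernel j (x - y)) * (h y * f y))" for h
  proof -
    have "riesz j (\<lambda>y. h y * f y) x = (LINT y|lebesgue. of_real (riesz_kernel j (x - y)) * (h y * f y))"
      using f0 e by (intro riesz_off_support[of e]) auto
    also have "\<dots> = (LINT y|lebesgue. indicator S y *\<^sub>R (of_real (riesz_kernel j (x - y)) * (h y * f y)))"
      by (intro Bochner_Integration.integral_cong refl) (use f0 in \<open>auto simp: indicator_def\<close>)
    finally show ?thesis using S by (subst integral_restrict_space) auto
  qed
  have K: "bmeas (lebesgue_on S) (\<lambda>y. complex_of_real (riesz_kernel j (x - y)))"
  proof (rule bmeasI[where B="1 / e ^ CARD('n)"])
    have "(\<lambda>y. complex_of_real (riesz_kernel j (x - y))) \<in> borel_measurable lborel" by measurable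
    then show "(\<lambda>y. complex_of_real (riesz_kernel j (x - y))) \<in> borel_measurable (lebesgue_on S)"
      by (intro measurable_restrict_space1 measurable_completion)
    show "norm (complex_of_real (riesz_kernel j (x - y))) \<le> 1 / e ^ CARD('n)" if "y \<in> space (lebesgue_on S)" for y
      using that e by (simp add: riesz_kernel_bound dist_norm)
  qed
  have i: "integrable (lebesgue_on S) (\<lambda>y. of_real (riesz_kernel j (x - y)) * (h y * f y))"
    if "bmeas (lebesgue_on S) h" for h
    by (intro bmeas_integrable finite_measure_lebesgue_on S bmeas_intros K that f)
  have "comm2 b1 b2 (riesz j) f x = b2 x * (b1 x * riesz j (\<lambda>y. 1 * f y) x - riesz j (\<lambda>y. b1 y * f y) x)
      - (b1 x * riesz j (\<lambda>y. b2 y * f y) x - riesz j (\<lambda>y. (b1 y * b2 y) * f y) x)"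
    by (simp add: comm2_def commutator_def mult_op_def mult.assoc)
  also have "\<dots> = (LINT y|lebesgue_on S. b2 x * (b1 x * (of_real (riesz_kernel j (x - y)) * (1 * f y)) 
        - of_real (riesz_kernel j (x - y)) * (b1 y * f y))
      - (b1 x * (of_real (riesz_kernel j (x - y)) * (b2 y * f y)) - of_real (riesz_kernel j (x - y)) * ((b1 y * b2 y) * f y)))"
    unfolding R using i[OF bmeas_const[of _ 1]] i[OF b(1)] i[OF b(2)] i[OF bmeas_mult[OF b]] by simp
  also have "\<dots> = (LINT y|lebesgue_on S. (b1 x - b1 y) * (b2 x - b2 y) * of_real (riesz_kernel j (x - y)) * f y)"
    by (intro Bochner_Integration.integral_cong refl) (simp add: algebra_simps)
  finally show ?thesis .
qed

section \<open>From the operator norm to estimates on separated sets\<close>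

lemma L2norm_le_iff: "N \<ge> 0 \<Longrightarrow> L2norm g \<le> ennreal N \<longleftrightarrow> (\<integral>\<^sup>+ x. ennreal ((norm (g x))\<^sup>2) \<partial>lebesgue) \<le> ennreal (N\<^sup>2)"
proof (cases "(\<integral>\<^sup>+ x. ennreal ((norm (g x))\<^sup>2) \<partial>lebesgue)")
  case (real r)
  assume "N \<ge> 0"
  then show ?thesis using real by (auto simp: L2norm_def intro: real_le_lsqrt sqrt_le_D)
next
  case top
  then show ?thesis by (simp add: L2norm_def top_unique)
qed

text \<open>Extended by zero and normalized, \<open>f\<close> is admissible in
  \<open>opnorm_L2\<close>. Restricting the output to \<open>S\<close> only lowers its norm, and
  there the off-support formula applies.\<close>

lemma comm2_riesz_local_bound:
  fixes b1 b2 f :: "'n::finite cfun"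
  assumes S: "S \<in> lmeasurable" and S': "S' \<in> lmeasurable" "bounded S'"
    and e: "e > 0" "\<And>x y. x \<in> S \<Longrightarrow> y \<in> S' \<Longrightarrow> e \<le> dist x y"
    and b: "bmeas (lebesgue_on S) b1" "bmeas (lebesgue_on S) b2"
    and b': "bmeas (lebesgue_on S') b1" "bmeas (lebesgue_on S') b2" and f: "bmeas (lebesgue_on S') f"
    and N: "N \<ge> 0" "opnorm_L2 (comm2 b1 b2 (riesz j)) \<le> ennreal N"
  shows "(LINT x|lebesgue_on S. (cmod (LINT y|lebesgue_on S'. 
      (b1 x - b1 y) * (b2 x - b2 y) * of_real (riesz_kernel j (x - y)) * f y))\<^sup>2) 
     \<le> N\<^sup>2 * (LINT y|lebesgue_on S'. (cmod (f y))\<^sup>2)"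
proof -
  let ?M = "lebesgue_on S" and ?M' = "lebesgue_on S'"
  have fin: "finite_measure ?M" "finite_measure ?M'" using S S' finite_measure_lebesgue_on by auto
  define K where "K x y = (b1 x - b1 y) * (b2 x - b2 y) * of_real (riesz_kernel j (x - y))" for x y
  have KM: "bmeas (?M \<Otimes>\<^sub>M ?M') (\<lambda>p. of_real (riesz_kernel j (fst p - snd p)) :: complex)"
  proof (rule bmeasI[where B="1 / e ^ CARD('n)"])
    have [measurable]: "(\<lambda>x. x) \<in> borel_measurable ?M" "(\<lambda>x. x) \<in> borel_measurable ?M'"
      by (auto intro!: measurable_restrict_space1 measurable_completion)
    show "(\<lambda>p. complex_of_real (riesz_kernel j (fst p - snd p))) \<in> borel_measurable (?M \<Otimes>\<^sub>M ?M')" by measurable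
    show "norm (complex_of_real (riesz_kernel j (fst p - snd p))) \<le> 1 / e ^ CARD('n)" if "p \<in> space (?M \<Otimes>\<^sub>M ?M')" for p
      using that e by (auto simp: riesz_kernel_bound space_pair_measure simp flip: dist_norm)
  qed
  have K12: "bmeas (?M \<Otimes>\<^sub>M ?M') (\<lambda>p. K (fst p) (snd p))"
    unfolding K_def by (intro bmeas_intros KM bmeas_fst bmeas_snd b b')
  define F where "F = (LINT y|?M'. (cmod (f y))\<^sup>2)"
  have F0: "F \<ge> 0" by (simp add: F_def)
  show ?thesis
  proof (cases "F = 0")
    \<comment> \<open>A function of norm zero cannot be normalized; here both sides are
      zero.\<close>
    case True
    then have "AE y in ?M'. (cmod (f y))\<^sup>2 = 0"
      unfolding F_def
      by (subst (asm) integral_nonneg_eq_0_iff_AE) (auto intro!: bmeas_integrable bmeas_intros fin f)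
    then have "(LINT y|?M'. K x y * f y) = 0" if "x \<in> space ?M" for x
      using bmeas_slice[OF K12 that] f
      by (subst integral_cong_AE[where g="\<lambda>_. 0"]) (auto simp: bmeas_def elim: eventually_mono)
    then have "(LINT x|?M. (cmod (LINT y|?M'. K x y * f y))\<^sup>2) = (LINT x|?M. 0)"
      by (intro Bochner_Integration.integral_cong refl) simp
    then show ?thesis using F0 by (simp add: K_def F_def)
  next
    case False
    then have F: "F > 0" using F0 by simp
    define g where "g y = (if y \<in> S' then f y / of_real (sqrt F) else 0)" for y
    have S'm: "S' \<in> sets lebesgue" using S' by auto
    have gf: "g y = (1 / of_real (sqrt F)) * f y" if "y \<in> space ?M'" for y using that by (simp add: g_def)
    have "bmeas ?M' (\<lambda>y. (1 / of_real (sqrt F)) * f y)" by (intro bmeas_intros f)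
    then have g: "bmeas ?M' g" using gf by (subst bmeas_cong)
    have gm: "g \<in> borel_measurable lebesgue"
    proof -
      have "(\<lambda>y. indicator S' y *\<^sub>R g y) \<in> borel_measurable lebesgue"
        using bmeasD[OF g] S'm by (subst (asm) borel_measurable_restrict_space_iff) auto
      moreover have "(\<lambda>y. indicator S' y *\<^sub>R g y) = g" by (auto simp: g_def indicator_def)
      ultimately show ?thesis by simp
    qed
    obtain B where B: "\<And>y. y \<in> S' \<Longrightarrow> cmod (g y) \<le> B" using g unfolding bmeas_def by auto
    have "cmod (g y) \<le> max B 0" for y using B[of y] by (cases "y \<in> S'") (auto simp: g_def)
    moreover have "bounded {x. g x \<noteq> 0}" by (rule bounded_subset[OF S'(2)]) (auto simp: g_def)
    ultimately have Lc: "Linfty_c g" using gm unfolding Linfty_c_def by blast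
    have "(\<integral>\<^sup>+ x. ennreal ((norm (g x))\<^sup>2) \<partial>lebesgue) = (\<integral>\<^sup>+ x. ennreal ((norm (g x))\<^sup>2) \<partial>?M')"
      using S'm by (subst nn_integral_restrict_space) (auto intro!: nn_integral_cong simp: g_def indicator_def)
    also have "\<dots> = ennreal (LINT x|?M'. (norm (g x))\<^sup>2)"
      by (intro nn_integral_eq_integral bmeas_integrable fin bmeas_intros g) auto
    also have "(LINT x|?M'. (norm (g x))\<^sup>2) = (LINT x|?M'. (norm (f x))\<^sup>2 / F)"
      using F by (intro Bochner_Integration.integral_cong refl) (simp add: g_def norm_divide power_divide)
    also have "\<dots> = 1" using F by (simp add: F_def)
    finally have "L2norm g \<le> ennreal 1" by (subst L2norm_le_iff) auto
    then have "L2norm (comm2 b1 b2 (riesz j) g) \<le> opnorm_L2 (comm2 b1 b2 (riesz j))"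
      unfolding opnorm_L2_def using Lc by (intro SUP_upper) auto
    also note N(2)
    finally have "(\<integral>\<^sup>+ x. ennreal ((norm (comm2 b1 b2 (riesz j) g x))\<^sup>2) \<partial>lebesgue) \<le> ennreal (N\<^sup>2)"
      using N(1) by (simp add: L2norm_le_iff)
    moreover have "(\<integral>\<^sup>+ x. ennreal ((norm (comm2 b1 b2 (riesz j) g x))\<^sup>2) \<partial>?M) \<le> (\<integral>\<^sup>+ x. ennreal ((norm (comm2 b1 b2 (riesz j) g x))\<^sup>2) \<partial>lebesgue)"
      using S by (subst nn_integral_restrict_space) (auto intro!: nn_integral_mono simp: indicator_def)
    moreover have "(\<integral>\<^sup>+ x. ennreal ((norm (comm2 b1 b2 (riesz j) g x))\<^sup>2) \<partial>?M) 
      = (\<integral>\<^sup>+ x. ennreal ((norm (LINT y|?M'. K x y * g y))\<^sup>2) \<partial>?M)"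
    proof (rule nn_integral_cong)
      fix x assume "x \<in> space ?M"
      then have "comm2 b1 b2 (riesz j) g x = (LINT y|?M'. K x y * g y)"
        unfolding K_def using e by (intro comm2_riesz_off_support[OF S'(1) e(1) _ b' g]) (auto simp: g_def)
      then show "ennreal ((norm (comm2 b1 b2 (riesz j) g x))\<^sup>2) = ennreal ((norm (LINT y|?M'. K x y * g y))\<^sup>2)" by simp
    qed
    moreover have "bmeas ?M (\<lambda>x. LINT y|?M'. K x y * g y)"
      using bmeas_integral[OF fin(2) bmeas_mult[OF K12 bmeas_snd[OF g]]] by simp
    then have "(\<integral>\<^sup>+ x. ennreal ((norm (LINT y|?M'. K x y * g y))\<^sup>2) \<partial>?M) = ennreal (LINT x|?M. (norm (LINT y|?M'. K x y * g y))\<^sup>2)"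
      by (intro nn_integral_eq_integral bmeas_integrable fin bmeas_intros) auto
    ultimately have "ennreal (LINT x|?M. (norm (LINT y|?M'. K x y * g y))\<^sup>2) \<le> ennreal (N\<^sup>2)"
      by (metis (no_types, lifting) order_trans)
    then have "(LINT x|?M. (norm (LINT y|?M'. K x y * g y))\<^sup>2) \<le> N\<^sup>2" by (simp add: ennreal_le_iff)
    moreover have "(LINT y|?M'. K x y * g y) = (LINT y|?M'. K x y * f y) / of_real (sqrt F)" for x
    proof -
      have "(LINT y|?M'. K x y * g y) = (LINT y|?M'. K x y * f y / of_real (sqrt F))"
        by (intro Bochner_Integration.integral_cong refl) (simp add: g_def)
      then show ?thesis by simp
    qed
    ultimately have "(LINT x|?M. (norm (LINT y|?M'. K x y * f y))\<^sup>2) / F \<le> N\<^sup>2"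
      using F by (simp add: norm_divide power_divide)
    then show ?thesis using F by (simp add: K_def F_def field_simps)
  qed
qed

text \<open>After division by the constant \<open>riesz_kernel j z0\<close> the kernel has the form
  \<open>k (1 + \<delta>)\<close> with \<open>k\<close> of rank at most 4, so the absorption lemma
  applies with the square of \<open>N / riesz_kernel j z0\<close> as its bound.\<close>

lemma local_Hilbert_Schmidt_bound:
  fixes b1 b2 :: "'n::finite cfun"
  assumes S: "S \<in> lmeasurable" and S': "S' \<in> lmeasurable" "bounded S'"
    and e: "e > 0" "\<And>x y. x \<in> S \<Longrightarrow> y \<in> S' \<Longrightarrow> e \<le> dist x y"
    and b: "bmeas (lebesgue_on S) b1" "bmeas (lebesgue_on S) b2"
    and b': "bmeas (lebesgue_on S') b1" "bmeas (lebesgue_on S') b2"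
    and N: "N \<ge> 0" "opnorm_L2 (comm2 b1 b2 (riesz j)) \<le> ennreal N"
    and K0: "riesz_kernel j z0 \<noteq> 0" 
    and K: "\<And>x y. x \<in> S \<Longrightarrow> y \<in> S' \<Longrightarrow> \<bar>riesz_kernel j (x - y) / riesz_kernel j z0 - 1\<bar> \<le> 1/4"
  shows "(\<integral>\<^sup>+x\<in>S. (\<integral>\<^sup>+y\<in>S'. ennreal ((cmod (b1 x - b1 y))\<^sup>2 * (cmod (b2 x - b2 y))\<^sup>2) \<partial>lebesgue) \<partial>lebesgue)
     \<le> ennreal (16 * (N / riesz_kernel j z0)\<^sup>2)"
proof -
  let ?M = "lebesgue_on S" and ?M' = "lebesgue_on S'"
  have fin: "finite_measure ?M" "finite_measure ?M'" using S S' finite_measure_lebesgue_on by auto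
  have Sm: "S \<in> sets lebesgue" "S' \<in> sets lebesgue" using S S' by auto
  define k where "k x y = (b1 x - b1 y) * (b2 x - b2 y)" for x y
  \<comment> \<open>The four products in the expansion of \<open>k\<close>. Larger indices also
    receive bounded functions, because the rank lemma asks for boundedness at every index.\<close>
  define a where "a i x = (if i = (0::nat) then b1 x * b2 x else if i = 1 then - b1 x else if i = 2 then - b2 x else 1)" for i x
  define c where "c i y = (if i = (0::nat) then 1 else if i = 1 then b2 y else if i = 2 then b1 y else b1 y * b2 y)" for i y
  have a: "bmeas ?M (a i)" for i 
    unfolding a_def by (cases "i = 0"; cases "i = 1"; cases "i = 2"; simp add: bmeas_intros bmeas_uminus b)
  have c: "bmeas ?M' (c i)" for i 
    unfolding c_def by (cases "i = 0"; cases "i = 1"; cases "i = 2"; simp add: bmeas_intros b')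
  have k: "k x y = (\<Sum>i<4. a i x * c i y)" for x y
    by (simp add: k_def a_def c_def eval_nat_numeral algebra_simps)
  define \<delta> where "\<delta> x y = complex_of_real (riesz_kernel j (x - y) / riesz_kernel j z0 - 1)" for x y
  have HS: "(LINT x|?M. LINT y|?M'. (cmod (k x y))\<^sup>2) \<le> 16 * (N / riesz_kernel j z0)\<^sup>2"
  proof (rule perturbed_rank4_Hilbert_Schmidt[where \<delta>=\<delta>, OF fin _ a c k])
    have [measurable]: "(\<lambda>x. x) \<in> borel_measurable ?M" "(\<lambda>x. x) \<in> borel_measurable ?M'"
      by (auto intro!: measurable_restrict_space1 measurable_completion)
    show "(\<lambda>p. \<delta> (fst p) (snd p)) \<in> borel_measurable (?M \<Otimes>\<^sub>M ?M')" unfolding \<delta>_def by measurable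
    show "cmod (\<delta> x y) \<le> 1/4" if "x \<in> space ?M" "y \<in> space ?M'" for x y
      using K[of x y] that unfolding \<delta>_def by (simp del: of_real_diff of_real_divide)
    fix f :: "'n cfun" assume f: "bmeas ?M' f"
    have "(LINT y|?M'. k x y * (1 + \<delta> x y) * f y) 
       = (LINT y|?M'. (b1 x - b1 y) * (b2 x - b2 y) * of_real (riesz_kernel j (x - y)) * f y) / of_real (riesz_kernel j z0)" for x
      unfolding integral_divide_zero[symmetric] 
      by (intro Bochner_Integration.integral_cong refl) (simp add: k_def \<delta>_def)
    then have "(LINT x|?M. (cmod (LINT y|?M'. k x y * (1 + \<delta> x y) * f y))\<^sup>2) 
        = (LINT x|?M. (cmod (LINT y|?M'. (b1 x - b1 y) * (b2 x - b2 y) * of_real (riesz_kernel j (x - y)) * f y))\<^sup>2) / (riesz_kernel j z0)\<^sup>2"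
      by (simp add: norm_divide power_divide)
    also have "\<dots> \<le> (N\<^sup>2 * (LINT y|?M'. (cmod (f y))\<^sup>2)) / (riesz_kernel j z0)\<^sup>2"
      by (intro divide_right_mono comm2_riesz_local_bound[OF S S' e b b' f N]) auto
    finally show "(LINT x|?M. (cmod (LINT y|?M'. k x y * (1 + \<delta> x y) * f y))\<^sup>2) \<le> (N / riesz_kernel j z0)\<^sup>2 * (LINT y|?M'. (cmod (f y))\<^sup>2)"
      by (simp add: power_divide)
  qed auto
  have k12: "bmeas (?M \<Otimes>\<^sub>M ?M') (\<lambda>p. k (fst p) (snd p))"
    unfolding k by (intro bmeas_intros bmeas_fst bmeas_snd a c)
  have "(\<integral>\<^sup>+x\<in>S. (\<integral>\<^sup>+y\<in>S'. ennreal ((cmod (k x y))\<^sup>2) \<partial>lebesgue) \<partial>lebesgue) = (\<integral>\<^sup>+x. (\<integral>\<^sup>+y. ennreal ((cmod (k x y))\<^sup>2) \<partial>?M') \<partial>?M)"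
    using Sm by (simp add: nn_integral_restrict_space)
  also have "\<dots> = (\<integral>\<^sup>+x. ennreal (LINT y|?M'. (cmod (k x y))\<^sup>2) \<partial>?M)"
  proof (rule nn_integral_cong)
    fix x assume "x \<in> space ?M"
    then show "(\<integral>\<^sup>+y. ennreal ((cmod (k x y))\<^sup>2) \<partial>?M') = ennreal (LINT y|?M'. (cmod (k x y))\<^sup>2)"
      using bmeas_slice[OF k12, of x] by (intro nn_integral_eq_integral bmeas_integrable fin bmeas_intros) auto
  qed
  also have "\<dots> = ennreal (LINT x|?M. LINT y|?M'. (cmod (k x y))\<^sup>2)"
    using bmeas_integral[OF fin(2) bmeas_cmod_sq[OF k12]]
    by (intro nn_integral_eq_integral bmeas_integrable fin bmeas_intros) auto
  finally show ?thesis using HS by (simp add: k_def norm_mult power_mult_distrib ennreal_leI)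
qed

subsection \<open>Whitney covering of the off-diagonal\<close>

text \<open>Serves the measurability of inner integrals with respect to Lebesgue measure; the Borel
  sets of a sigma-finite cover keep their measure in the completion.\<close>

lemma sigma_finite_lebesgue: "sigma_finite_measure (lebesgue :: 'a::euclidean_space measure)"
proof
  obtain A :: "'a set set" where A: "countable A" "A \<subseteq> sets lborel" "\<Union>A = space lborel" "\<forall>a\<in>A. emeasure lborel a \<noteq> \<infinity>"
    using lborel.sigma_finite_countable by blast
  then show "\<exists>A::'a set set. countable A \<and> A \<subseteq> sets lebesgue \<and> \<Union>A = space lebesgue \<and> (\<forall>a\<in>A. emeasure lebesgue a \<noteq> \<infinity>)"
    by (intro exI[of _ A]) (auto simp: subset_iff)
qed

interpretation lebesgue: sigma_finite_measure "lebesgue :: 'a::euclidean_space measure"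
  by (rule sigma_finite_lebesgue)

text \<open>The squared modulus of the kernel \<open>k\<close>, with values in
  \<open>ennreal\<close>, so that its iterated integrals make sense before any finiteness is
  known.\<close>

definition sqdiff :: "'n::finite cfun \<Rightarrow> 'n cfun \<Rightarrow> real^'n \<Rightarrow> real^'n \<Rightarrow> ennreal" where
  "sqdiff b1 b2 x y = ennreal ((cmod (b1 x - b1 y))\<^sup>2 * (cmod (b2 x - b2 y))\<^sup>2)"

lemma sqdiff_measurable:
  assumes [measurable]: "b1 \<in> borel_measurable lebesgue" "b2 \<in> borel_measurable lebesgue"
  shows "(\<lambda>p. sqdiff b1 b2 (fst p) (snd p)) \<in> borel_measurable (lebesgue \<Otimes>\<^sub>M lebesgue)"
  unfolding sqdiff_def by measurable

text \<open>The symbols need not be bounded on balls. The local bound is applied on the parts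
  \<open>E\<close> where both moduli are at most \<open>n\<close>; it does not depend on
  \<open>n\<close>, and Fatou's lemma, used in each variable, passes to the full balls.\<close>

lemma sqdiff_rectangle_bound:
  obtains \<eta> :: real where "\<eta> > 0" "\<eta> \<le> 1/4"
    "\<And>(b1 :: 'n::finite cfun) b2 N x0 y0 \<rho>. b1 \<in> borel_measurable lebesgue \<Longrightarrow> b2 \<in> borel_measurable lebesgue \<Longrightarrow> N \<ge> 0 \<Longrightarrow>
       (\<And>j. opnorm_L2 (comm2 b1 b2 (riesz j)) \<le> ennreal N) \<Longrightarrow> x0 \<noteq> y0 \<Longrightarrow> \<rho> \<le> \<eta> * dist x0 y0 \<Longrightarrow>
       (\<integral>\<^sup>+x\<in>cball x0 \<rho>. (\<integral>\<^sup>+y\<in>cball y0 \<rho>. sqdiff b1 b2 x y \<partial>lebesgue) \<partial>lebesgue)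
         \<le> ennreal (16 * (N * real CARD('n) * dist x0 y0 ^ CARD('n))\<^sup>2)"
proof -
  obtain \<eta> :: real where \<eta>: "\<eta> > 0" "\<eta> \<le> 1/4" and K:
    "\<And>z0 :: real^'n. z0 \<noteq> 0 \<Longrightarrow> \<exists>j. riesz_kernel j z0 \<noteq> 0 \<and> 1 / \<bar>riesz_kernel j z0\<bar> \<le> real CARD('n) * norm z0 ^ CARD('n)
       \<and> (\<forall>z. norm (z - z0) \<le> 2 * \<eta> * norm z0 \<longrightarrow> \<bar>riesz_kernel j z / riesz_kernel j z0 - 1\<bar> \<le> 1/4)"
    by (rule riesz_kernel_nearly_constant[where 'n='n]) blast
  have "(\<integral>\<^sup>+x\<in>cball x0 \<rho>. (\<integral>\<^sup>+y\<in>cball y0 \<rho>. sqdiff b1 b2 x y \<partial>lebesgue) \<partial>lebesgue)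
         \<le> ennreal (16 * (N * real CARD('n) * dist x0 y0 ^ CARD('n))\<^sup>2)"
    if b[measurable]: "b1 \<in> borel_measurable lebesgue" "b2 \<in> borel_measurable lebesgue"
      and N: "N \<ge> 0" "\<And>j. opnorm_L2 (comm2 b1 b2 (riesz j)) \<le> ennreal N" and xy: "x0 \<noteq> y0" and \<rho>: "\<rho> \<le> \<eta> * dist x0 y0"
    for b1 b2 :: "'n cfun" and N \<rho> :: real and x0 y0 :: "real^'n"
  proof -
    define D where "D = dist x0 y0"
    have D: "D > 0" using xy by (simp add: D_def)
    define E where "E z n = {x \<in> cball z \<rho>. cmod (b1 x) \<le> real n \<and> cmod (b2 x) \<le> real n}" for z :: "real^'n" and n :: nat
    obtain j where j: "riesz_kernel j (x0 - y0) \<noteq> 0" "1 / \<bar>riesz_kernel j (x0 - y0)\<bar> \<le> real CARD('n) * D ^ CARD('n)"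
       "\<And>z. norm (z - (x0 - y0)) \<le> 2 * \<eta> * D \<Longrightarrow> \<bar>riesz_kernel j z / riesz_kernel j (x0 - y0) - 1\<bar> \<le> 1/4"
      using K[of "x0 - y0"] xy by (auto simp: D_def dist_norm)
    have E_sets: "E z n \<in> sets lebesgue" for z n
    proof -
      have "E z n = cball z \<rho> \<inter> {x \<in> space lebesgue. cmod (b1 x) \<le> real n \<and> cmod (b2 x) \<le> real n}" by (auto simp: E_def)
      also have "\<dots> \<in> sets lebesgue" by (rule sets.Int) (simp, measurable)
      finally show ?thesis .
    qed
    have Em: "E z n \<in> lmeasurable" for z n
      by (rule fmeasurableI2[OF lmeasurable_cball[of z \<rho>] _ E_sets]) (auto simp: E_def)
    have Eb: "bmeas (lebesgue_on (E z n)) b1" "bmeas (lebesgue_on (E z n)) b2" for z n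
      by (rule bmeasI[where B="real n"]; auto simp: E_def intro!: measurable_restrict_space1)+
    have local: "(\<integral>\<^sup>+x\<in>E x0 n. (\<integral>\<^sup>+y\<in>E y0 n. sqdiff b1 b2 x y \<partial>lebesgue) \<partial>lebesgue) \<le> ennreal (16 * (N * real CARD('n) * D ^ CARD('n))\<^sup>2)" for n
    proof -
      have "(\<integral>\<^sup>+x\<in>E x0 n. (\<integral>\<^sup>+y\<in>E y0 n. sqdiff b1 b2 x y \<partial>lebesgue) \<partial>lebesgue) \<le> ennreal (16 * (N / riesz_kernel j (x0 - y0))\<^sup>2)"
        unfolding sqdiff_def
      proof (rule local_Hilbert_Schmidt_bound[OF Em Em _ _ _ Eb Eb N(1) N(2) j(1)])
        show "bounded (E y0 n)" by (rule bounded_subset[OF bounded_cball]) (auto simp: E_def)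
        show "D / 2 > 0" using D by simp
        fix x y assume xy: "x \<in> E x0 n" "y \<in> E y0 n"
        then have d: "dist x0 x \<le> \<eta> * D" "dist y0 y \<le> \<eta> * D" using \<rho> by (auto simp: E_def D_def)
        \<comment> \<open>Each radius is at most \<open>D / 4\<close>, so half the distance of the
          centers remains between the balls.\<close>
        have "\<eta> * D \<le> 1/4 * D" using \<eta> D by (intro mult_right_mono) auto
        then show "D / 2 \<le> dist x y"
          using d dist_triangle[of x0 y0 x] dist_triangle[of x y0 y] unfolding D_def[symmetric] by (simp add: dist_commute)
        have "norm ((x - y) - (x0 - y0)) \<le> norm (x - x0) + norm (y - y0)"
          using norm_triangle_ineq4[of "x - x0" "y - y0"] by (simp add: algebra_simps)
        then have "norm ((x - y) - (x0 - y0)) \<le> 2 * \<eta> * D" using d by (simp add: dist_norm norm_minus_commute)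
        then show "\<bar>riesz_kernel j (x - y) / riesz_kernel j (x0 - y0) - 1\<bar> \<le> 1/4" by (rule j(3))
      qed
      also have "(N / riesz_kernel j (x0 - y0))\<^sup>2 = (N * (1 / \<bar>riesz_kernel j (x0 - y0)\<bar>))\<^sup>2"
        by (simp add: power_divide)
      also have "\<dots> \<le> (N * (real CARD('n) * D ^ CARD('n)))\<^sup>2"
        using j(2) N(1) by (intro power_mono mult_left_mono) auto
      finally show ?thesis by (simp add: mult.assoc ennreal_leI)
    qed
    \<comment> \<open>At each point both symbols are finite, so the truncated sets agree with the
      ball from some index on.\<close>
    have ev: "eventually (\<lambda>n. (indicator (E z n) x :: ennreal) = indicator (cball z \<rho>) x) sequentially" for z x
    proof -
      obtain n0 where n0: "max (cmod (b1 x)) (cmod (b2 x)) \<le> real n0" using real_arch_simple by blast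
      show ?thesis by (rule eventually_sequentiallyI[of n0]) (use n0 in \<open>auto simp: E_def indicator_def\<close>)
    qed
    have m: "(\<lambda>p. sqdiff b1 b2 (fst p) (snd p)) \<in> borel_measurable (lebesgue \<Otimes>\<^sub>M lebesgue)" 
      by (intro sqdiff_measurable b)
    have m1: "sqdiff b1 b2 x \<in> borel_measurable lebesgue" for x
      unfolding sqdiff_def[abs_def] by measurable
    have [measurable]: "E z n \<in> sets lebesgue" for z n by (rule E_sets)
    define h where "h n x = (\<integral>\<^sup>+y\<in>E y0 n. sqdiff b1 b2 x y \<partial>lebesgue)" for n x
    have hm[measurable]: "h n \<in> borel_measurable lebesgue" for n
    proof -
      have "(\<lambda>p. sqdiff b1 b2 (fst p) (snd p) * indicator (E y0 n) (snd p)) \<in> borel_measurable (lebesgue \<Otimes>\<^sub>M lebesgue)"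
        by (intro borel_measurable_times_ennreal m) measurable
      then show ?thesis unfolding h_def 
        by (intro lebesgue.borel_measurable_nn_integral) (simp add: case_prod_unfold)
    qed
    have inner: "(\<integral>\<^sup>+y\<in>cball y0 \<rho>. sqdiff b1 b2 x y \<partial>lebesgue) \<le> liminf (\<lambda>n. h n x)" for x
    proof -
      have "liminf (\<lambda>n. sqdiff b1 b2 x y * indicator (E y0 n) y) = sqdiff b1 b2 x y * indicator (cball y0 \<rho>) y" for y
        by (intro lim_imp_Liminf tendsto_eventually) (use ev[of y0 y] in \<open>auto elim: eventually_mono\<close>)
      then have "(\<integral>\<^sup>+y\<in>cball y0 \<rho>. sqdiff b1 b2 x y \<partial>lebesgue) = (\<integral>\<^sup>+y. liminf (\<lambda>n. sqdiff b1 b2 x y * indicator (E y0 n) y) \<partial>lebesgue)"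
        by simp
      also have "\<dots> \<le> liminf (\<lambda>n. h n x)"
        unfolding h_def by (rule nn_integral_liminf) (use m1 in measurable)
      finally show ?thesis .
    qed
    have outer: "(\<integral>\<^sup>+y\<in>cball y0 \<rho>. sqdiff b1 b2 x y \<partial>lebesgue) * indicator (cball x0 \<rho>) x \<le> liminf (\<lambda>n. h n x * indicator (E x0 n) x)" for x
    proof (cases "x \<in> cball x0 \<rho>")
      case True
      then have "eventually (\<lambda>n. h n x * indicator (E x0 n) x = h n x) sequentially"
        using ev[of x0 x] by (auto elim: eventually_mono)
      then have "liminf (\<lambda>n. h n x * indicator (E x0 n) x) = liminf (\<lambda>n. h n x)" by (rule Liminf_eq)
      then show ?thesis using inner[of x] True by simp
    qed simp
    have "(\<integral>\<^sup>+x\<in>cball x0 \<rho>. (\<integral>\<^sup>+y\<in>cball y0 \<rho>. sqdiff b1 b2 x y \<partial>lebesgue) \<partial>lebesgue) \<le> (\<integral>\<^sup>+x. liminf (\<lambda>n. h n x * indicator (E x0 n) x) \<partial>lebesgue)"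
      by (intro nn_integral_mono outer)
    also have "\<dots> \<le> liminf (\<lambda>n. \<integral>\<^sup>+x. h n x * indicator (E x0 n) x \<partial>lebesgue)"
      by (rule nn_integral_liminf) measurable
    also have "\<dots> \<le> ennreal (16 * (N * real CARD('n) * D ^ CARD('n))\<^sup>2)"
      using local by (intro Liminf_le) (auto simp: h_def)
    finally show ?thesis unfolding D_def .
  qed
  with \<eta> show ?thesis using that by blast
qed

text \<open>The off-diagonal part of \<open>Q \<times> Q\<close> is covered by Whitney-type balls, whose disjoint subfamily comes from the
  Vitali covering lemma; on the diagonal \<open>sqdiff\<close> vanishes.\<close>

lemma sqdiff_cube_bound:
  obtains C :: real where "C > 0"
    "\<And>(b1 :: 'n::finite cfun) b2 N Q. b1 \<in> borel_measurable lebesgue \<Longrightarrow> b2 \<in> borel_measurable lebesgue \<Longrightarrow> N \<ge> 0 \<Longrightarrow>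
       (\<And>j. opnorm_L2 (comm2 b1 b2 (riesz j)) \<le> ennreal N) \<Longrightarrow> is_cube Q \<Longrightarrow>
       (\<integral>\<^sup>+x\<in>Q. (\<integral>\<^sup>+y\<in>Q. sqdiff b1 b2 x y \<partial>lebesgue) \<partial>lebesgue) \<le> ennreal (C * N\<^sup>2 * (measure lebesgue Q)\<^sup>2)"
proof -
  let ?d = "CARD('n)"
  obtain \<eta> :: real where \<eta>: "\<eta> > 0" "\<eta> \<le> 1/4" and R:
    "\<And>(b1 :: 'n::finite cfun) b2 N x0 y0 \<rho>. b1 \<in> borel_measurable lebesgue \<Longrightarrow> b2 \<in> borel_measurable lebesgue \<Longrightarrow> N \<ge> 0 \<Longrightarrow>
       (\<And>j. opnorm_L2 (comm2 b1 b2 (riesz j)) \<le> ennreal N) \<Longrightarrow> x0 \<noteq> y0 \<Longrightarrow> \<rho> \<le> \<eta> * dist x0 y0 \<Longrightarrow>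
       (\<integral>\<^sup>+x\<in>cball x0 \<rho>. (\<integral>\<^sup>+y\<in>cball y0 \<rho>. sqdiff b1 b2 x y \<partial>lebesgue) \<partial>lebesgue)
         \<le> ennreal (16 * (N * real CARD('n) * dist x0 y0 ^ CARD('n))\<^sup>2)"
    by (rule sqdiff_rectangle_bound[where 'n='n]) blast
  \<comment> \<open>The factor 16 and the square of the dimension come from the estimate on products
    of balls, \<open>5 / \<eta>\<close> is the ratio of distance to Vitali radius, and
    \<open>3 * real ?d\<close> times the side is the radius of an enclosing ball in dimension
    \<open>2 * ?d\<close>.\<close>
  define C where "C = 16 * (real ?d)\<^sup>2 * (5 / \<eta>) ^ (2 * ?d) * (3 * real ?d) ^ (2 * ?d)"
  have C: "C > 0" using \<eta> by (simp add: C_def)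
  have "(\<integral>\<^sup>+x\<in>Q. (\<integral>\<^sup>+y\<in>Q. sqdiff b1 b2 x y \<partial>lebesgue) \<partial>lebesgue) \<le> ennreal (C * N\<^sup>2 * (measure lebesgue Q)\<^sup>2)"
    if b[measurable]: "b1 \<in> borel_measurable lebesgue" "b2 \<in> borel_measurable lebesgue"
      and N: "N \<ge> 0" "\<And>j. opnorm_L2 (comm2 b1 b2 (riesz j)) \<le> ennreal N" and Q: "is_cube Q" 
    for b1 b2 :: "'n cfun" and N :: real and Q :: "(real^'n) set"
  proof -
    obtain q s where s: "s > 0" and Qeq: "Q = cbox q (q + s *\<^sub>R One)" using Q by (auto simp: is_cube_def)
    have One_nth: "(One :: real^'n) $ i = 1" for i
      by (simp add: cart_eq_inner_axis inner_sum_left_Basis axis_in_Basis_iff)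
    have "Q \<noteq> {}" using s unfolding Qeq by (simp add: box_ne_empty inner_add_left inner_sum_left_Basis)
    then have mQ: "measure lebesgue Q = s ^ ?d"
      unfolding Qeq by (simp add: content_cbox_cart One_nth del: sum_component)
    have distQ: "dist x y \<le> real ?d * s" if "x \<in> Q" "y \<in> Q" for x y
    proof -
      have "q $ i \<le> z $ i \<and> z $ i \<le> q $ i + s" if "z \<in> Q" for z i
        using that unfolding Qeq mem_box_cart by (simp add: One_nth del: sum_component)
      from this[OF that(1)] this[OF that(2)] have "\<bar>(x - y) $ i\<bar> \<le> s" for i
        by (smt (verit) vector_minus_component)
      then have "(\<Sum>i\<in>UNIV. \<bar>(x - y) $ i\<bar>) \<le> (\<Sum>i\<in>(UNIV::'n set). s)" by (intro sum_mono)
      then show ?thesis using norm_le_l1_cart[of "x - y"] by (simp add: dist_norm)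
    qed
    have qQ: "q \<in> Q" using s by (simp add: Qeq mem_box_cart One_nth del: sum_component)
    define \<Omega> where "\<Omega> = {p \<in> Q \<times> Q. fst p \<noteq> snd p}"
    \<comment> \<open>The fivefold radius of the Vitali lemma is then \<open>\<eta>\<close> times
      the distance, exactly what \<open>R\<close> permits.\<close>
    define r where "r p = \<eta> / 5 * dist (fst p) (snd p)" for p :: "(real^'n) \<times> (real^'n)"
    have r: "0 < r p \<and> r p \<le> \<eta> / 5 * (real ?d * s)" if "p \<in> \<Omega>" for p
      using that \<eta> distQ[of "fst p" "snd p"] by (auto simp: r_def \<Omega>_def)
    have cov0: "\<Omega> \<subseteq> (\<Union>p\<in>\<Omega>. cball p (r p))" using r by (force intro: less_imp_le)
    obtain I where I: "countable I" "I \<subseteq> \<Omega>" "pairwise (\<lambda>i j. disjnt (cball i (r i)) (cball j (r j))) I"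
      and cov: "\<Omega> \<subseteq> (\<Union>i\<in>I. cball i (5 * r i))"
      by (rule Vitali_covering_lemma_cballs[OF cov0 r])
    \<comment> \<open>The enlarged ball around \<open>i\<close> in the product space lies in
      \<open>P i \<times> P' i\<close>, a product of two balls.\<close>
    define P where "P i = cball (fst i) (5 * r i)" for i :: "(real^'n) \<times> (real^'n)"
    define P' where "P' i = cball (snd i) (5 * r i)" for i :: "(real^'n) \<times> (real^'n)"
    have m: "(\<lambda>p. sqdiff b1 b2 (fst p) (snd p)) \<in> borel_measurable (lebesgue \<Otimes>\<^sub>M lebesgue)" 
      by (intro sqdiff_measurable b)
    have m1[measurable]: "sqdiff b1 b2 x \<in> borel_measurable lebesgue" for x
      unfolding sqdiff_def[abs_def] by measurable
    have [measurable]: "P i \<in> sets lebesgue" "P' i \<in> sets lebesgue" for i by (auto simp: P_def P'_def)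
    have hm[measurable]: "(\<lambda>x. \<integral>\<^sup>+y\<in>P' i. sqdiff b1 b2 x y \<partial>lebesgue) \<in> borel_measurable lebesgue" for i
    proof -
      have "(\<lambda>p. sqdiff b1 b2 (fst p) (snd p) * indicator (P' i) (snd p)) \<in> borel_measurable (lebesgue \<Otimes>\<^sub>M lebesgue)"
        by (intro borel_measurable_times_ennreal m) measurable
      then show ?thesis
        by (intro lebesgue.borel_measurable_nn_integral) (simp add: case_prod_unfold)
    qed
    \<comment> \<open>The sum over the cover is written as an integral over counting measure, which
      can be exchanged with the Lebesgue integrals because \<open>I\<close> is countable.\<close>
    have pt: "sqdiff b1 b2 x y * indicator Q y * indicator Q x \<le> (\<integral>\<^sup>+i. sqdiff b1 b2 x y * indicator (P' i) y * indicator (P i) x \<partial>count_space I)" for x y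
    proof (cases "(x, y) \<in> \<Omega>")
      case True
      then obtain i where i: "i \<in> I" "(x, y) \<in> cball i (5 * r i)" using cov by blast
      then have "x \<in> P i" "y \<in> P' i"
        using dist_fst_le[of i "(x,y)"] dist_snd_le[of i "(x,y)"] by (auto simp: P_def P'_def)
      moreover have "sqdiff b1 b2 x y * indicator (P' i) y * indicator (P i) x
         = (\<integral>\<^sup>+k. (sqdiff b1 b2 x y * indicator (P' k) y * indicator (P k) x) * indicator {i} k \<partial>count_space I)"
        using i(1) by (subst nn_integral_indicator_singleton) auto
      moreover have "\<dots> \<le> (\<integral>\<^sup>+i. sqdiff b1 b2 x y * indicator (P' i) y * indicator (P i) x \<partial>count_space I)"
        by (intro nn_integral_mono) (auto simp: indicator_def)
      ultimately show ?thesis using True by (simp add: \<Omega>_def)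
    next
      case False
      then have "x \<notin> Q \<or> y \<notin> Q \<or> sqdiff b1 b2 x y = 0" by (auto simp: \<Omega>_def sqdiff_def)
      then show ?thesis by auto
    qed
    have "(\<integral>\<^sup>+x\<in>Q. (\<integral>\<^sup>+y\<in>Q. sqdiff b1 b2 x y \<partial>lebesgue) \<partial>lebesgue) 
       = (\<integral>\<^sup>+x. (\<integral>\<^sup>+y. sqdiff b1 b2 x y * indicator Q y * indicator Q x \<partial>lebesgue) \<partial>lebesgue)"
      by (subst nn_integral_multc) (auto intro!: borel_measurable_times_ennreal borel_measurable_indicator m1 simp: Qeq)
    also have "\<dots> \<le> (\<integral>\<^sup>+x. (\<integral>\<^sup>+y. (\<integral>\<^sup>+i. sqdiff b1 b2 x y * indicator (P' i) y * indicator (P i) x \<partial>count_space I) \<partial>lebesgue) \<partial>lebesgue)"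
      by (intro nn_integral_mono pt)
    also have "\<dots> = (\<integral>\<^sup>+x. (\<integral>\<^sup>+i. (\<integral>\<^sup>+y. sqdiff b1 b2 x y * indicator (P' i) y * indicator (P i) x \<partial>lebesgue) \<partial>count_space I) \<partial>lebesgue)"
      by (intro nn_integral_cong nn_integral_count_space_nn_integral I) measurable
    also have "\<dots> = (\<integral>\<^sup>+x. (\<integral>\<^sup>+i. (\<integral>\<^sup>+y. sqdiff b1 b2 x y * indicator (P' i) y \<partial>lebesgue) * indicator (P i) x \<partial>count_space I) \<partial>lebesgue)"
      by (subst nn_integral_multc) auto
    also have "\<dots> = (\<integral>\<^sup>+i. (\<integral>\<^sup>+x. (\<integral>\<^sup>+y. sqdiff b1 b2 x y * indicator (P' i) y \<partial>lebesgue) * indicator (P i) x \<partial>lebesgue) \<partial>count_space I)"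
      by (intro nn_integral_count_space_nn_integral I) measurable
    also have "\<dots> \<le> (\<integral>\<^sup>+i. ennreal (16 * (N * real ?d)\<^sup>2 * (5 / \<eta>) ^ (2 * ?d)) * ennreal (r i ^ (2 * ?d)) \<partial>count_space I)"
    proof (rule nn_integral_mono)
      fix i assume "i \<in> space (count_space I)"
      then have i: "fst i \<noteq> snd i" using I by (auto simp: \<Omega>_def)
      have "(\<integral>\<^sup>+x. (\<integral>\<^sup>+y. sqdiff b1 b2 x y * indicator (P' i) y \<partial>lebesgue) * indicator (P i) x \<partial>lebesgue) 
         \<le> ennreal (16 * (N * real ?d * dist (fst i) (snd i) ^ ?d)\<^sup>2)"
        unfolding P_def P'_def by (intro R b N i) (simp add: r_def)
      \<comment> \<open>The power \<open>2 * ?d\<close> of the distance becomes that power of the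
        radius, which is proportional to the volume of the ball around \<open>i\<close>;
        disjointness can therefore control the sum.\<close>
      also have "dist (fst i) (snd i) = 5 / \<eta> * r i" using \<eta> by (simp add: r_def)
      also have "16 * (N * real ?d * (5 / \<eta> * r i) ^ ?d)\<^sup>2 = 16 * (N * real ?d)\<^sup>2 * (5 / \<eta>) ^ (2 * ?d) * r i ^ (2 * ?d)"
        by (simp only: power_mult_distrib power_mult power2_eq_square power_even_eq) (simp add: algebra_simps)
      finally show "(\<integral>\<^sup>+x. (\<integral>\<^sup>+y. sqdiff b1 b2 x y * indicator (P' i) y \<partial>lebesgue) * indicator (P i) x \<partial>lebesgue) 
         \<le> ennreal (16 * (N * real ?d)\<^sup>2 * (5 / \<eta>) ^ (2 * ?d)) * ennreal (r i ^ (2 * ?d))"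
        using \<eta> by (subst ennreal_mult'[symmetric]) auto
    qed
    also have "\<dots> = ennreal (16 * (N * real ?d)\<^sup>2 * (5 / \<eta>) ^ (2 * ?d)) * (\<integral>\<^sup>+i. ennreal (r i ^ (2 * ?d)) \<partial>count_space I)"
      by (simp add: nn_integral_cmult)
    also have "(\<integral>\<^sup>+i. ennreal (r i ^ (2 * ?d)) \<partial>count_space I) \<le> ennreal ((3 * real ?d * s) ^ (2 * ?d))"
    proof -
      \<comment> \<open>Packing: the disjoint balls lie in \<open>B\<close>, since their centers are
        within \<open>2 * ?d * s\<close> of \<open>(q, q)\<close> and their radii are at most
        \<open>?d * s\<close>. Comparing volumes cancels \<open>V\<close>.\<close>
      define B :: "((real^'n) \<times> (real^'n)) set" where "B = cball (q, q) (3 * real ?d * s)"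
      define V where "V = unit_ball_vol (real (2 * ?d))"
      have V: "V > 0" by (simp add: V_def)
      have ball: "emeasure lborel (cball p t) = ennreal V * ennreal (t ^ (2 * ?d))" if "t \<ge> 0" for p :: "(real^'n) \<times> (real^'n)" and t
      proof -
        have "emeasure lborel (cball p t) = ennreal (V * t ^ (2 * ?d))"
          using emeasure_cball[OF that, of p] by (simp add: V_def power_add power_mult power2_eq_square power_mult_distrib)
        then show ?thesis using V that by (simp only: ennreal_mult less_imp_le zero_le_power)
      qed
      have sub: "cball i (r i) \<subseteq> B" if "i \<in> I" for i
      proof -
        have i: "i \<in> \<Omega>" using that I by auto
        then have fs: "fst i \<in> Q" "snd i \<in> Q" by (auto simp: \<Omega>_def)
        have "dist i (q, q) \<le> dist (fst i) q + dist (snd i) q"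
          by (cases i) (auto simp: dist_Pair_Pair intro!: sqrt_sum_squares_le_sum)
        also have "\<dots> \<le> 2 * (real ?d * s)" using distQ[OF fs(1) qQ] distQ[OF fs(2) qQ] by simp
        finally have 1: "dist i (q, q) \<le> 2 * (real ?d * s)" .
        have "r i \<le> \<eta> / 5 * (real ?d * s)" using r[OF i] by simp
        also have "\<dots> \<le> 1 * (real ?d * s)" using \<eta> s by (intro mult_right_mono) auto
        finally have "r i \<le> real ?d * s" by simp
        with 1 show ?thesis unfolding B_def by (auto simp: cball_subset_cball_iff dist_commute)
      qed
      have "ennreal V * (\<integral>\<^sup>+i. ennreal (r i ^ (2 * ?d)) \<partial>count_space I) = (\<integral>\<^sup>+i. ennreal V * ennreal (r i ^ (2 * ?d)) \<partial>count_space I)"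
        by (simp add: nn_integral_cmult)
      also have "\<dots> = (\<integral>\<^sup>+i. emeasure lborel (cball i (r i)) \<partial>count_space I)"
        using I r by (intro nn_integral_cong) (subst ball, auto simp: less_imp_le)
      also have "\<dots> = emeasure lborel (\<Union>i\<in>I. cball i (r i))"
        using I by (subst emeasure_UN_countable) (auto simp: disjoint_family_on_def pairwise_def disjnt_def)
      also have "\<dots> \<le> emeasure lborel B" using sub by (intro emeasure_mono) (auto simp: B_def)
      also have "\<dots> = ennreal V * ennreal ((3 * real ?d * s) ^ (2 * ?d))" unfolding B_def using s by (subst ball) auto
      finally show ?thesis using V by (simp add: ennreal_mult_le_mult_iff)
    qed
    also have "ennreal (16 * (N * real ?d)\<^sup>2 * (5 / \<eta>) ^ (2 * ?d)) * ennreal ((3 * real ?d * s) ^ (2 * ?d)) = ennreal (C * N\<^sup>2 * (measure lebesgue Q)\<^sup>2)"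
      unfolding mQ C_def using \<eta> s
      by (subst ennreal_mult'[symmetric]) (auto simp: power_mult_distrib algebra_simps simp flip: power_even_eq)
    finally show ?thesis by (simp add: mult_left_mono)
  qed
  with C show ?thesis using that by blast
qed

subsection \<open>Oscillations on cubes\<close>

lemma locLp_integrable_on:
  fixes b :: "'n::finite cfun"
  assumes b: "locLp p b" and Q: "compact Q"
  shows "integrable (lebesgue_on Q) (\<lambda>x. norm (b x) powr p)"
proof (rule integrableI_nonneg)
  have [measurable]: "b \<in> borel_measurable lebesgue" using b by (simp add: locLp_def)
  have Qs: "Q \<in> sets lebesgue" using Q by (simp add: borel_compact)
  show "(\<lambda>x. norm (b x) powr p) \<in> borel_measurable (lebesgue_on Q)"
    by (intro measurable_restrict_space1) measurable
  show "(\<integral>\<^sup>+x. ennreal (norm (b x) powr p) \<partial>lebesgue_on Q) < \<infinity>"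
    using b Q Qs by (simp add: nn_integral_restrict_space locLp_def)
qed auto

text \<open>Every monomial of degree at most 3 in \<open>|f|\<close> and \<open>|g|\<close> is at
  most \<open>max 1 (max |f| |g|) ^ 3\<close>, hence at most \<open>1 + |f| ^ 3 + |g| ^ 3\<close>.
  The mixed third order terms of the double difference are what calls for third powers.\<close>

lemma integrable_low_degree_L3:
  fixes f g :: "'a \<Rightarrow> complex"
  assumes fin: "finite_measure M" and fm[measurable]: "f \<in> borel_measurable M" and gm[measurable]: "g \<in> borel_measurable M"
    and f: "integrable M (\<lambda>x. norm (f x) ^ 3)" and g: "integrable M (\<lambda>x. norm (g x) ^ 3)"
  shows "integrable M f" "integrable M (\<lambda>x. f x * g x)" "integrable M (\<lambda>x. (norm (f x))\<^sup>2)"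
     "integrable M (\<lambda>x. of_real ((norm (f x))\<^sup>2) * g x)"
proof -
  have H: "integrable M (\<lambda>x. 1 + norm (f x) ^ 3 + norm (g x) ^ 3)"
    by (intro Bochner_Integration.integrable_add f g finite_measure.integrable_const[OF fin])
  have *: "r \<le> 1 + a ^ 3 + b ^ 3"
    if "0 \<le> a" "0 \<le> b" "r \<le> max 1 (max a b) ^ 3" for a b r :: real
  proof -
    have "max 1 (max a b) ^ 3 \<le> 1 + a ^ 3 + b ^ 3" using that by (auto simp: max_def)
    then show ?thesis using that(3) by linarith
  qed
  have mono: "a \<le> 1 + a ^ 3 + b ^ 3" "a * b \<le> 1 + a ^ 3 + b ^ 3" "a\<^sup>2 \<le> 1 + a ^ 3 + b ^ 3" "a\<^sup>2 * b \<le> 1 + a ^ 3 + b ^ 3"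
    if ab: "0 \<le> a" "0 \<le> b" for a b :: real
  proof -
    define t where "t = max 1 (max a b)"
    have t: "1 \<le> t" "a \<le> t" "b \<le> t" "0 \<le> t" by (auto simp: t_def)
    have t3: "t ^ 3 = t * t * t" by (simp add: power3_eq_cube)
    have "a * 1 * 1 \<le> t ^ 3" "a * b * 1 \<le> t ^ 3" "a * a * 1 \<le> t ^ 3" "a * a * b \<le> t ^ 3"
      unfolding t3 using ab t by (intro mult_mono; simp)+
    then show "a \<le> 1 + a ^ 3 + b ^ 3" "a * b \<le> 1 + a ^ 3 + b ^ 3" "a\<^sup>2 \<le> 1 + a ^ 3 + b ^ 3" "a\<^sup>2 * b \<le> 1 + a ^ 3 + b ^ 3"
      using ab by (auto intro!: * simp: t_def power2_eq_square)
  qed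
  show "integrable M f" "integrable M (\<lambda>x. f x * g x)" "integrable M (\<lambda>x. (norm (f x))\<^sup>2)"
     "integrable M (\<lambda>x. of_real ((norm (f x))\<^sup>2) * g x)"
    by (rule Bochner_Integration.integrable_bound[OF H]; simp add: mono norm_mult norm_power)+
qed

lemma integrable_cube_diff_const:
  fixes f :: "'a \<Rightarrow> complex"
  assumes fin: "finite_measure M" and fm[measurable]: "f \<in> borel_measurable M"
    and f: "integrable M (\<lambda>x. norm (f x) ^ 3)"
  shows "integrable M (\<lambda>x. norm (f x - c) ^ 3)"
proof (rule Bochner_Integration.integrable_bound)
  show "integrable M (\<lambda>x. 8 * (norm (f x) ^ 3 + norm c ^ 3))"
    by (intro integrable_mult_right Bochner_Integration.integrable_add f finite_measure.integrable_const[OF fin])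
  show "AE x in M. norm (norm (f x - c) ^ 3) \<le> norm (8 * (norm (f x) ^ 3 + norm c ^ 3))"
  proof (rule AE_I2)
    fix x
    have "norm (f x - c) ^ 3 \<le> (2 * max (norm (f x)) (norm c)) ^ 3"
      using norm_triangle_ineq4[of "f x" c] by (intro power_mono) auto
    also have "\<dots> \<le> 8 * (norm (f x) ^ 3 + norm c ^ 3)" by (auto simp: max_def power_mult_distrib)
    finally show "norm (norm (f x - c) ^ 3) \<le> norm (8 * (norm (f x) ^ 3 + norm c ^ 3))" by simp
  qed
qed measurable

text \<open>The double difference inequality gives
  \<open>2 * m * T + 2 * U * V \<le> C * m\<^sup>2\<close>, where \<open>U\<close>, \<open>V\<close>
  and \<open>T\<close> integrate \<open>|u|\<^sup>2\<close>, \<open>|v|\<^sup>2\<close> and their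
  product over \<open>Q\<close>. Both terms on the left are nonnegative, so each yields one of the
  claims after division by \<open>m\<^sup>2\<close>.\<close>

lemma oscillations_le_of_sqdiff_bound:
  fixes b1 b2 :: "'n::finite cfun"
  assumes b: "locLp 3 b1" "locLp 3 b2" "locLp 2 (\<lambda>x. b1 x * b2 x)" and Q: "is_cube Q" and C: "C \<ge> 0"
    and bd: "(\<integral>\<^sup>+x\<in>Q. (\<integral>\<^sup>+y\<in>Q. sqdiff b1 b2 x y \<partial>lebesgue) \<partial>lebesgue) \<le> ennreal (C * (measure lebesgue Q)\<^sup>2)"
  shows "osc 2 Q b1 * osc 2 Q b2 \<le> sqrt C"
   "((LINT y:Q|lebesgue. norm (b1 y - avg Q b1) powr 2 * norm (b2 y - avg Q b2) powr 2) / measure lebesgue Q) powr (1/2) \<le> sqrt C"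
proof -
  let ?M = "lebesgue_on Q"
  obtain q s where s: "s > 0" and Qeq: "Q = cbox q (q + s *\<^sub>R One)" using Q by (auto simp: is_cube_def)
  have cQ: "compact Q" and Qm: "Q \<in> lmeasurable" and Qs: "Q \<in> sets lebesgue" unfolding Qeq by auto
  have fin: "finite_measure ?M" using Qm by (rule finite_measure_lebesgue_on)
  define m where "m = measure lebesgue Q"
  have mM: "measure ?M (space ?M) = m" using Qs by (simp add: m_def measure_restrict_space)
  have mM': "measure ?M Q = m" using mM by simp
  have m0: "m > 0"
    unfolding m_def Qeq using s by (simp add: content_pos_lt inner_add_left inner_sum_left_Basis)
  have set_int: "(LINT y:Q|lebesgue. f y) = (LINT y|?M. f y)" for f :: "real^'n \<Rightarrow> 'b::{banach,second_countable_topology}"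
    unfolding set_lebesgue_integral_def using Qs by (subst integral_restrict_space) auto
  have bm: "b1 \<in> borel_measurable ?M" "b2 \<in> borel_measurable ?M"
    using b by (auto simp: locLp_def intro: measurable_restrict_space1)
  have b3: "integrable ?M (\<lambda>x. norm (b1 x) ^ 3)" "integrable ?M (\<lambda>x. norm (b2 x) ^ 3)"
    using locLp_integrable_on[OF b(1) cQ] locLp_integrable_on[OF b(2) cQ] by (simp_all add: powr_numeral)
  have b12: "integrable ?M (\<lambda>x. (norm (b1 x * b2 x))\<^sup>2)"
    using locLp_integrable_on[OF b(3) cQ] by (simp add: powr_numeral)
  define c1 where "c1 = avg Q b1"
  define c2 where "c2 = avg Q b2"
  define u where "u x = b1 x - c1" for x
  define v where "v x = b2 x - c2" for x
  note bi = integrable_low_degree_L3[OF fin bm b3] integrable_low_degree_L3[OF fin bm(2,1) b3(2,1)]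
  have um: "u \<in> borel_measurable ?M" "v \<in> borel_measurable ?M" unfolding u_def v_def using bm by auto
  have u3: "integrable ?M (\<lambda>x. norm (u x) ^ 3)" "integrable ?M (\<lambda>x. norm (v x) ^ 3)"
    unfolding u_def v_def by (intro integrable_cube_diff_const fin bm b3)+
  note ui = integrable_low_degree_L3[OF fin um u3] and vi = integrable_low_degree_L3[OF fin um(2,1) u3(2,1)]
  note const = finite_measure.integrable_const[OF fin]
  have u0: "(LINT x|?M. u x) = 0" "(LINT x|?M. v x) = 0"
    unfolding u_def v_def using bi m0
    by (simp_all add: const c1_def c2_def avg_def set_int m_def[symmetric] mM' scaleR_conv_of_real)
  \<comment> \<open>This fourth order term does not follow from third powers; it rests on
    \<open>b1 * b2\<close> being locally square integrable, through
    \<open>u v = b1 b2 - c1 b2 - c2 b1 + c1 c2\<close>.\<close>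
  have pq: "integrable ?M (\<lambda>x. (cmod (u x))\<^sup>2 * (cmod (v x))\<^sup>2)"
  proof (rule Bochner_Integration.integrable_bound)
    show "integrable ?M (\<lambda>x. 4 * (norm (b1 x * b2 x))\<^sup>2 + 4 * (cmod c1)\<^sup>2 * (cmod (b2 x))\<^sup>2
       + (4 * (cmod c2)\<^sup>2 * (cmod (b1 x))\<^sup>2 + 4 * (cmod (c1 * c2))\<^sup>2))"
      by (intro Bochner_Integration.integrable_add integrable_mult_right const bi b12)
    show "(\<lambda>x. (cmod (u x))\<^sup>2 * (cmod (v x))\<^sup>2) \<in> borel_measurable ?M" using um by measurable
    show "AE x in ?M. norm ((cmod (u x))\<^sup>2 * (cmod (v x))\<^sup>2) \<le> norm (4 * (norm (b1 x * b2 x))\<^sup>2 + 4 * (cmod c1)\<^sup>2 * (cmod (b2 x))\<^sup>2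
       + (4 * (cmod c2)\<^sup>2 * (cmod (b1 x))\<^sup>2 + 4 * (cmod (c1 * c2))\<^sup>2))"
    proof (rule AE_I2)
      fix x
      have "(cmod (u x))\<^sup>2 * (cmod (v x))\<^sup>2 = (cmod ((b1 x * b2 x + - (c1 * b2 x)) + (- (c2 * b1 x) + c1 * c2)))\<^sup>2"
        by (simp add: u_def v_def algebra_simps flip: norm_mult power_mult_distrib)
      also have "\<dots> \<le> 2 * (2 * (norm (b1 x * b2 x))\<^sup>2 + 2 * (norm (- (c1 * b2 x)))\<^sup>2) + 2 * (2 * (norm (- (c2 * b1 x)))\<^sup>2 + 2 * (norm (c1 * c2))\<^sup>2)"
        by (intro order_trans[OF cmod_add_sq_le] add_mono mult_left_mono cmod_add_sq_le) auto
      finally show "norm ((cmod (u x))\<^sup>2 * (cmod (v x))\<^sup>2) \<le> norm (4 * (norm (b1 x * b2 x))\<^sup>2 + 4 * (cmod c1)\<^sup>2 * (cmod (b2 x))\<^sup>2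
       + (4 * (cmod c2)\<^sup>2 * (cmod (b1 x))\<^sup>2 + 4 * (cmod (c1 * c2))\<^sup>2))"
        by (simp add: norm_mult power_mult_distrib)
    qed
  qed
  define T where "T = (LINT x|?M. (cmod (u x))\<^sup>2 * (cmod (v x))\<^sup>2)"
  define U where "U = (LINT x|?M. (cmod (u x))\<^sup>2)"
  define V where "V = (LINT x|?M. (cmod (v x))\<^sup>2)"
  have nn: "T \<ge> 0" "U \<ge> 0" "V \<ge> 0" by (auto simp: T_def U_def V_def)
  have "ennreal (2 * m * T + 2 * U * V)
    \<le> (\<integral>\<^sup>+x. (\<integral>\<^sup>+y. ennreal ((cmod (u x - u y))\<^sup>2 * (cmod (v x - v y))\<^sup>2) \<partial>?M) \<partial>?M)"
    unfolding T_def U_def V_def mM[symmetric]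
    by (rule integral_double_difference_ge[OF fin ui(1) vi(1) ui(2) ui(3) vi(3) pq ui(4) vi(4) u0])
  \<comment> \<open>The subtracted means cancel in the differences.\<close>
  also have "\<dots> = (\<integral>\<^sup>+x\<in>Q. (\<integral>\<^sup>+y\<in>Q. sqdiff b1 b2 x y \<partial>lebesgue) \<partial>lebesgue)"
    using Qs by (simp add: nn_integral_restrict_space sqdiff_def u_def v_def)
  also note bd
  finally have main: "2 * m * T + 2 * U * V \<le> C * m\<^sup>2"
    using C by (simp add: m_def[symmetric])
  have "U * V \<ge> 0" "m * T \<ge> 0" using nn m0 by auto
  with main have "m * T \<le> C * m\<^sup>2" "U * V \<le> C * m\<^sup>2" by linarith+
  then have T: "T / m \<le> C" and UV: "(U / m) * (V / m) \<le> C"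
    using m0 by (simp_all add: power2_eq_square field_simps)
  have "osc 2 Q b1 = sqrt (U / m)" "osc 2 Q b2 = sqrt (V / m)"
    using nn m0 by (simp_all add: osc_def set_int powr_numeral U_def V_def u_def v_def c1_def c2_def m_def powr_half_sqrt)
  then show "osc 2 Q b1 * osc 2 Q b2 \<le> sqrt C" using UV by (simp flip: real_sqrt_mult)
  have "((LINT y:Q|lebesgue. norm (b1 y - avg Q b1) powr 2 * norm (b2 y - avg Q b2) powr 2) / measure lebesgue Q) powr (1/2) = sqrt (T / m)"
    using nn m0 by (simp add: set_int powr_numeral T_def u_def v_def c1_def c2_def m_def powr_half_sqrt)
  then show "((LINT y:Q|lebesgue. norm (b1 y - avg Q b1) powr 2 * norm (b2 y - avg Q b2) powr 2) / measure lebesgue Q) powr (1/2) \<le> sqrt C"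
    using T by simp
qed

theorem theorem2p4:
  "\<exists>C::real. C > 0 \<and> (\<forall>b1 b2 :: 'n::finite cfun.
     locLp 3 b1 \<and> locLp 3 b2 \<and> locLp 2 (\<lambda>x. b1 x * b2 x) \<longrightarrow>
     Sp 2 b1 b2 + Tp 2 b1 b2 \<le> ennreal C * (\<Sum>j\<in>UNIV. opnorm_L2 (comm2 b1 b2 (riesz j))))"
proof -
  obtain C :: real where C: "C > 0" and bound:
    "\<And>(b1 :: 'n::finite cfun) b2 N Q. b1 \<in> borel_measurable lebesgue \<Longrightarrow> b2 \<in> borel_measurable lebesgue \<Longrightarrow> N \<ge> 0 \<Longrightarrow>
       (\<And>j. opnorm_L2 (comm2 b1 b2 (riesz j)) \<le> ennreal N) \<Longrightarrow> is_cube Q \<Longrightarrow>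
       (\<integral>\<^sup>+x\<in>Q. (\<integral>\<^sup>+y\<in>Q. sqdiff b1 b2 x y \<partial>lebesgue) \<partial>lebesgue) \<le> ennreal (C * N\<^sup>2 * (measure lebesgue Q)\<^sup>2)"
    by (rule sqdiff_cube_bound[where 'n='n]) blast
  \<comment> \<open>The square root reflects that the oscillations are controlled through squared
    averages; the factor 2 counts \<open>Sp\<close> and \<open>Tp\<close>.\<close>
  have "Sp 2 b1 b2 + Tp 2 b1 b2 \<le> ennreal (2 * sqrt C) * (\<Sum>j\<in>UNIV. opnorm_L2 (comm2 b1 b2 (riesz j)))"
    if b: "locLp 3 b1" "locLp 3 b2" "locLp 2 (\<lambda>x. b1 x * b2 x)" for b1 b2 :: "'n cfun"
  proof (cases "\<Sum>j\<in>UNIV. opnorm_L2 (comm2 b1 b2 (riesz j))")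
    \<comment> \<open>An infinite sum makes the right side infinite, since its factor is
      positive.\<close>
    case top
    then show ?thesis using C by (simp only: top) (simp add: ennreal_mult_top)
  next
    case (real N)
    \<comment> \<open>The sum bounds each of its terms, so one \<open>N\<close> serves whichever
      \<open>j\<close> the geometry selects.\<close>
    have N: "opnorm_L2 (comm2 b1 b2 (riesz j)) \<le> ennreal N" for j
      unfolding real(2)[symmetric] by (rule member_le_sum) auto
    have bm: "b1 \<in> borel_measurable lebesgue" "b2 \<in> borel_measurable lebesgue" using b by (auto simp: locLp_def)
    have s: "sqrt (C * N\<^sup>2) = sqrt C * N" using real(1) by (simp add: real_sqrt_mult)
    have "C * N\<^sup>2 \<ge> 0" using C by simp
    note cb = oscillations_le_of_sqdiff_bound[OF b _ this bound[OF bm real(1) N], unfolded s]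
    have "Sp 2 b1 b2 \<le> ennreal (sqrt C * N)"
      unfolding Sp_def by (intro SUP_least ennreal_leI) (use cb(1) in auto)
    moreover have "Tp 2 b1 b2 \<le> ennreal (sqrt C * N)"
      unfolding Tp_def by (intro SUP_least ennreal_leI) (use cb(2) in auto)
    ultimately have "Sp 2 b1 b2 + Tp 2 b1 b2 \<le> ennreal (sqrt C * N) + ennreal (sqrt C * N)" by (rule add_mono)
    also have "\<dots> = ennreal (2 * sqrt C) * ennreal N"
      using C real(1) by (simp flip: ennreal_plus ennreal_mult)
    finally show ?thesis by (simp only: real(2))
  qed
  then show ?thesis using C by (intro exI[of _ "2 * sqrt C"]) auto
qed

end
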